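(* Let $\{Z_n\}_{n\ge 0}$ be a branching random walk on $\mathbb{R}$ with offspring law $\{p_k\}_{k\ge0}$ and step size $X$, satisfying: $p_0=0$, $1<m<\infty$, $\mathbb{E}[X]=0$, $\mathbb{P}(X=0)<1$, and $\mathbb{E}[e^{\kappa X}]<\infty$ for some $\kappa>0$. Assume $\mathbb{E}[e^{\theta |Z_1|}]<\infty$ for some $\theta>0$, $x\in(0,L)$ and $a\in((\log m-I(x))^+,\log m)$. Suppose $L<\infty$ and one of the following two conditions holds: (i) $x^*=L$; (ii) $x^*<L$ and $y_s/s>L$ for all $s\in\left(0,1-\frac{a}{\log m}\right]$. Then $$0<\liminf_{n\to\infty}\frac{1}{n}\log\left[-\log\mathbb{P}(Z_n([xn,\infty))\geq e^{an})\right]\leq\limsup_{n\to\infty}\frac{1}{n}\log\left[-\log\mathbb{P}(Z_n([xn,\infty))\geq e^{an})\right]\leq c^*\log b,$$ where $b:=\inf\{k\ge m: p_k>0\}$ and $c^*\in(0,\frac{x}{L})$ is the unique solution of the equation (with respect to $c$) $$\log m-I\left(L+\frac{x-L}{1-c}\right)-\frac{a-\log b}{1-c}=\log b.$$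
   Context: Branching random walk: at time $0$ there is one particle at the origin ($Z_0=\delta_0$). At each time step every particle dies and produces a random number of offspring according to $\{p_k\}_{k\ge0}$, after which each offspring moves from its parent's position by an independent displacement distributed as $X$; the branching and the motion are independent, and different particles behave independently. $Z_n$ is the point process (counting measure) of positions of the particles at generation $n$; $Z_n(A)$ is the number of generation-$n$ particles located in $A\subset\mathbb{R}$; $|Z_n|:=Z_n(\mathbb{R})$; $m:=\mathbb{E}[|Z_1|]=\sum_k kp_k$. Notation: $I(x):=\sup_{t\ge0}\{tx-\log\mathbb{E}[e^{tX}]\}\in[0,\infty]$; $L:=\sup\{x\in\mathbb{R}:\mathbb{P}(X>x)>0\}\in(-\infty,\infty]$ is the essential supremum of $X$; $x^*:=\sup\{y\ge0: I(y)\le\log m\}$; $r^+:=\max\{r,0\}$. For $s\in\left(0,1-\frac{a}{\log m}\right]$, $y_s$ denotes the unique solution $y\in(0,x]$ of the equation $$\log m-I\left(\frac{x-y}{1-s}\right)=\frac{a}{1-s}.$$ *)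

theory Defs
  imports "HOL-Probability.Probability"
begin

text \<open>
  Particles carry Ulam--Harris labels, listed from the most recent generation backwards:
  \<open>[]\<close> is the initial particle and \<open>i # u\<close> is the \<open>i\<close>-th child (counted from \<open>0\<close>) of \<open>u\<close>.
  \<open>N u\<close> is the number of children of \<open>u\<close>, and \<open>D u i\<close> the displacement of the \<open>i\<close>-th child
  of \<open>u\<close> from \<open>u\<close>. Both are given for every label; only those of particles
  that are actually born enter the process.
\<close>

primrec born :: "(nat list \<Rightarrow> 'w \<Rightarrow> nat) \<Rightarrow> 'w \<Rightarrow> nat list \<Rightarrow> bool" where
  "born N \<omega> [] \<longleftrightarrow> True"
| "born N \<omega> (i # u) \<longleftrightarrow> born N \<omega> u \<and> i < N u \<omega>"

primrec position :: "(nat list \<Rightarrow> nat \<Rightarrow> 'w \<Rightarrow> real) \<Rightarrow> 'w \<Rightarrow> nat list \<Rightarrow> real" where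
  "position D \<omega> [] = 0"
| "position D \<omega> (i # u) = position D \<omega> u + D u i \<omega>"

text \<open>The labels of a given length that are born form a finite set, so \<open>card\<close> is a genuine count.\<close>

definition brw_count ::
  "(nat list \<Rightarrow> 'w \<Rightarrow> nat) \<Rightarrow> (nat list \<Rightarrow> nat \<Rightarrow> 'w \<Rightarrow> real) \<Rightarrow> nat \<Rightarrow> real set \<Rightarrow> 'w \<Rightarrow> nat" where
  "brw_count N D n A \<omega> = card {u. length u = n \<and> born N \<omega> u \<and> position D \<omega> u \<in> A}"

text \<open>
  \<open>p\<close> is the offspring law and \<open>\<mu>\<close> the law of the step \<open>X\<close>. Library independence of a family
  requires a single value type, hence the coercion of offspring numbers to reals;
  the last assumption is the joint mutual independence of all offspring numbers and all displacements.
\<close>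

locale branching_random_walk = prob_space M
  for M :: "'w measure" and p :: "nat pmf" and \<mu> :: "real measure"
    and N :: "nat list \<Rightarrow> 'w \<Rightarrow> nat" and D :: "nat list \<Rightarrow> nat \<Rightarrow> 'w \<Rightarrow> real" +
  assumes step_law: "real_distribution \<mu>"
    and offspring_measurable: "\<And>u. random_variable (count_space UNIV) (N u)"
    and offspring_distr: "\<And>u. distr M (count_space UNIV) (N u) = measure_pmf p"
    and displacement_measurable: "\<And>u i. random_variable borel (D u i)"
    and displacement_distr: "\<And>u i. distr M borel (D u i) = \<mu>"
    and independent: "indep_vars (\<lambda>_. borel)
      (\<lambda>j. case j of Inl u \<Rightarrow> (\<lambda>\<omega>. real (N u \<omega>)) | Inr (u, i) \<Rightarrow> D u i) UNIV"

definition offspring_mean :: "nat pmf \<Rightarrow> real" where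
  "offspring_mean p = (\<Sum>k. real k * pmf p k)"

text \<open>The logarithm on \<open>[0, \<infinity>]\<close>, with \<open>log 0 = -\<infinity>\<close> and \<open>log \<infinity> = \<infinity>\<close>.\<close>

definition elog :: "ereal \<Rightarrow> ereal" where
  "elog r = (if r \<le> 0 then -\<infinity> else if r = \<infinity> then \<infinity> else ereal (ln (real_of_ereal r)))"

definition rate :: "real measure \<Rightarrow> real \<Rightarrow> ereal" where
  "rate \<mu> x = (SUP t\<in>{0..}.
     ereal (t * x) - elog (enn2ereal (\<integral>\<^sup>+ y. ennreal (exp (t * y)) \<partial>\<mu>)))"

definition step_sup :: "real measure \<Rightarrow> ereal" where
  "step_sup \<mu> = Sup {ereal y | y. measure \<mu> {y<..} > 0}"

definition max_speed :: "nat pmf \<Rightarrow> real measure \<Rightarrow> ereal" where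
  "max_speed p \<mu> = Sup {ereal y | y. 0 \<le> y \<and> rate \<mu> y \<le> ereal (ln (offspring_mean p))}"

definition y_sol :: "nat pmf \<Rightarrow> real measure \<Rightarrow> real \<Rightarrow> real \<Rightarrow> real \<Rightarrow> real" where
  "y_sol p \<mu> x a s = (THE y. 0 < y \<and> y \<le> x \<and>
     ereal (ln (offspring_mean p)) - rate \<mu> ((x - y) / (1 - s)) = ereal (a / (1 - s)))"

definition b_val :: "nat pmf \<Rightarrow> nat" where
  "b_val p = Inf {k. real k \<ge> offspring_mean p \<and> pmf p k > 0}"

definition solves_c_eq ::
  "nat pmf \<Rightarrow> real measure \<Rightarrow> real \<Rightarrow> real \<Rightarrow> real \<Rightarrow> real \<Rightarrow> bool" where
  "solves_c_eq p \<mu> L x a c \<longleftrightarrow>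
     ereal (ln (offspring_mean p)) - rate \<mu> (L + (x - L) / (1 - c))
       - ereal ((a - ln (real (b_val p))) / (1 - c)) = ereal (ln (real (b_val p)))"

end

theory Submission
  imports Defs "HOL-Real_Asymp.Real_Asymp"
begin

text \<open>
  The number of particles beyond \<open>x * n\<close> is the sum, over the children of the initial particle, of the corresponding
  counts in independent copies of the process. The estimates of these counts are inductions on the number of
  generations that use only this (\<open>nn_integral_first_generation\<close>).

  Upper bound on the probability. Let \<open>T r y\<close> be the probability that a single lineage advances by at least \<open>y\<close> in
  \<open>r\<close> generations, so that the expected count is \<open>m ^ r * T r y\<close>. If \<open>\<beta>\<close> is so small that \<open>\<beta>\<close> times the expected
  number of successful descendants of a particle is small for every place and time that a particle can reach, then
  \<open>exp\<close> is nearly linear throughout the induction, and the exponential moment of \<open>\<beta>\<close> times the count stays bounded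
  (\<open>exp_moment_le\<close>). A particle can be at most at \<open>s * n * L\<close> at time \<open>s * n\<close>, and by Chernoff's bound it then has at
  most \<open>exp (h s * n)\<close> successful descendants on average, where
  \<open>h s = (1 - s) * (log m - I ((x - s * L) / (1 - s)))\<close>. So \<open>\<beta>\<close> may be of order \<open>exp (- \<gamma> * n)\<close> with \<open>\<gamma>\<close>
  slightly above the maximum of \<open>h\<close>, and Markov's inequality gives a probability of at most
  \<open>exp (- exp ((a - \<gamma>) * n))\<close>, up to constants (\<open>double_exponential_decay\<close>). Either of the conditions (i) and (ii) says
  that \<open>h < a\<close> everywhere (\<open>growth_less\<close>): in case (i) convexity of \<open>I\<close> yields \<open>h s \<le> log m - I x\<close>; in case (ii)
  \<open>y_s\<close> is the position from which a particle at time \<open>s\<close> has \<open>exp (a * n)\<close> successful descendants on average, and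
  it lies beyond \<open>s * L\<close>.

  Lower bound on the probability. Let all particles of the first \<open>c * n\<close> generations have \<open>b\<close> children and move at
  speed nearly \<open>L\<close>. These are of the order of \<open>b ^ (c * n)\<close> independent events of fixed probability. Each of the resulting
  \<open>b ^ (c * n)\<close> subtrees then reaches half of its expected count with probability at least \<open>exp (- O(n))\<close>, by a second
  moment argument that recycles the exponential moment (\<open>success_base\<close>), and the expected count is found from Cramer's
  theorem (\<open>cramer_lower\<close>). The total is \<open>exp (g c * n)\<close> with \<open>g c = c * log b + h c\<close>, so the strategy works as soon as
  \<open>g c > a\<close>, at a cost that is \<open>b ^ (c * n)\<close> up to a polynomial factor in the exponent
  (\<open>double_exponential_attained\<close>). The function \<open>g\<close> is concave, starts below \<open>a\<close> and lies above \<open>a\<close> at \<open>x / L\<close>;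
  hence \<open>g c = a\<close> has exactly one solution, and \<open>g > a\<close> to its right (\<open>critical_time\<close>).
\<close>

section \<open>The recursion over the first generation\<close>

type_synonym coord = "nat list + nat list \<times> nat"

text \<open>
  One configuration of the whole process: all offspring numbers (under \<open>Inl\<close>, as reals) and all
  displacements (under \<open>Inr\<close>) in a single family, indexed as in the joint independence assumption.
\<close>

definition family ::
  "(nat list \<Rightarrow> 'w \<Rightarrow> nat) \<Rightarrow> (nat list \<Rightarrow> nat \<Rightarrow> 'w \<Rightarrow> real) \<Rightarrow> 'w \<Rightarrow> coord \<Rightarrow> real" where
  "family N D \<omega> = (\<lambda>j. case j of Inl u \<Rightarrow> real (N u \<omega>) | Inr (u, i) \<Rightarrow> D u i \<omega>)"

text \<open>
  Labels grow at the front, so the first ancestor is the last entry: \<open>f \<circ> graft i\<close> is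
  the configuration of the subtree rooted at the child \<open>i\<close> of the initial particle.
\<close>

definition graft :: "nat \<Rightarrow> coord \<Rightarrow> coord" where
  "graft i = map_sum (\<lambda>u. u @ [i]) (map_prod (\<lambda>u. u @ [i]) id)"

text \<open>
  The number of particles of generation \<open>n\<close> at or beyond \<open>y\<close>, computed from the root: a child that has
  moved by \<open>d\<close> still has to cover \<open>y - d\<close>. This recursion, rather than one over the last generation, makes
  independence and measurability arguments inductions over identically distributed subtrees.
\<close>

primrec descendants :: "nat \<Rightarrow> real \<Rightarrow> (coord \<Rightarrow> real) \<Rightarrow> nat" where
  "descendants 0 y f = (if y \<le> 0 then 1 else 0)"
| "descendants (Suc n) y f =
     (\<Sum>i<nat \<lfloor>f (Inl [])\<rfloor>. descendants n (y - f (Inr ([], i))) (f \<circ> graft i))"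

lemma family_graft: "family N D \<omega> \<circ> graft i = family (\<lambda>u. N (u @ [i])) (\<lambda>u. D (u @ [i])) \<omega>"
  by (auto simp: family_def graft_def fun_eq_iff split: sum.splits)

lemma inj_graft: "inj (graft i)"
  unfolding graft_def by (intro sum.inj_map prod.inj_map) (auto simp: inj_def)

lemma born_append: "born N \<omega> (u @ [i]) \<longleftrightarrow> i < N [] \<omega> \<and> born (\<lambda>v. N (v @ [i])) \<omega> u"
  by (induction u) auto

lemma position_append: "position D \<omega> (u @ [i]) = D [] i \<omega> + position (\<lambda>v. D (v @ [i])) \<omega> u"
  by (induction u) auto

text \<open>
  A label of length \<open>n + 1\<close> is \<open>u @ [i]\<close> with \<open>i\<close> a child of the root, and \<open>u\<close> is then a label of
  the subtree of \<open>i\<close>; finiteness travels along because \<open>card\<close> of an infinite set would be \<open>0\<close>.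
\<close>

lemma brw_count_eq_descendants:
  "finite {u. length u = n \<and> born N \<omega> u \<and> position D \<omega> u \<in> {y..}} \<and>
   brw_count N D n {y..} \<omega> = descendants n y (family N D \<omega>)"
proof (induction n arbitrary: N D y)
  case 0
  have "{u. length u = 0 \<and> born N \<omega> u \<and> position D \<omega> u \<in> {y..}} = (if y \<le> 0 then {[]} else {})"
    by auto
  then show ?case by (simp add: brw_count_def)
next
  case (Suc n)
  define S where "S i = {u. length u = n \<and> born (\<lambda>v. N (v @ [i])) \<omega> u \<and>
     position (\<lambda>v. D (v @ [i])) \<omega> u \<in> {y - D [] i \<omega>..}}" for i
  have S: "finite (S i)" "card (S i) = descendants n (y - D [] i \<omega>) (family N D \<omega> \<circ> graft i)" for i
    using Suc[of "\<lambda>v. N (v @ [i])" "\<lambda>v. D (v @ [i])" "y - D [] i \<omega>"]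
    by (simp_all add: S_def brw_count_def family_graft)
  have eq: "{u. length u = Suc n \<and> born N \<omega> u \<and> position D \<omega> u \<in> {y..}} =
      (\<Union>i<N [] \<omega>. (\<lambda>u. u @ [i]) ` S i)" (is "?L = ?R")
  proof (intro set_eqI iffI)
    fix w assume w: "w \<in> ?L"
    then obtain u i where "w = u @ [i]" by (cases w rule: rev_cases) auto
    with w show "w \<in> ?R"
      by (auto simp: S_def born_append position_append intro!: bexI[of _ i] imageI)
  qed (auto simp: S_def born_append position_append)
  have "card ?L = (\<Sum>i<N [] \<omega>. card ((\<lambda>u. u @ [i]) ` S i))"
    unfolding eq by (rule card_UN_disjoint) (auto simp: S)
  also have "\<dots> = (\<Sum>i<N [] \<omega>. card (S i))"
    by (intro sum.cong refl card_image) (auto simp: inj_on_def)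
  also have "\<dots> = descendants (Suc n) y (family N D \<omega>)"
    by (simp add: S, simp add: family_def)
  finally show ?case
    using S unfolding eq brw_count_def by auto
qed

lemma measurable_graft [measurable]:
  "(\<lambda>f. f \<circ> graft i) \<in> PiM UNIV (\<lambda>_. borel) \<rightarrow>\<^sub>M PiM UNIV (\<lambda>_. borel :: real measure)"
  by (auto simp: comp_def intro!: measurable_PiM_single')

text \<open>
  The sum over children has a random number of terms; it is measurable because that number takes
  countably many values. Joint measurability in the level is needed since the displacement shifts it.
\<close>

lemma measurable_descendants:
  "(\<lambda>x. descendants n (fst x) (snd x)) \<in> borel \<Otimes>\<^sub>M PiM UNIV (\<lambda>_. borel) \<rightarrow>\<^sub>M count_space UNIV"
proof (induction n)
  case 0
  show ?case by simp
next
  case (Suc n)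
  let ?X = "borel \<Otimes>\<^sub>M PiM UNIV (\<lambda>_::coord. borel :: real measure) :: (real \<times> (coord \<Rightarrow> real)) measure"
  have sub: "(\<lambda>x. descendants n (fst x - snd x (Inr ([], i))) (snd x \<circ> graft i)) \<in> ?X \<rightarrow>\<^sub>M count_space UNIV" for i
  proof -
    have "(\<lambda>x. (fst x - snd x (Inr ([], i)), snd x \<circ> graft i)) \<in> ?X \<rightarrow>\<^sub>M ?X"
      by measurable
    from measurable_compose[OF this Suc] show ?thesis by (simp add: comp_def)
  qed
  have "(\<lambda>x. \<Sum>i<k. descendants n (fst x - snd x (Inr ([], i))) (snd x \<circ> graft i))
      \<in> ?X \<rightarrow>\<^sub>M count_space UNIV" for k
    using sub by (induction k) auto
  moreover have "(\<lambda>x::real \<times> (coord \<Rightarrow> real). nat \<lfloor>snd x (Inl [])\<rfloor>) \<in> ?X \<rightarrow>\<^sub>M count_space UNIV"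
    by measurable
  ultimately have "(\<lambda>x. (\<lambda>k x. \<Sum>i<k. descendants n (fst x - snd x (Inr ([], i))) (snd x \<circ> graft i))
      (nat \<lfloor>snd x (Inl [])\<rfloor>) x) \<in> ?X \<rightarrow>\<^sub>M count_space UNIV"
    by (rule measurable_compose_countable)
  then show ?case by simp
qed

lemma measurable_descendants' [measurable (raw)]:
  assumes [measurable]: "g \<in> borel_measurable A" "h \<in> A \<rightarrow>\<^sub>M PiM UNIV (\<lambda>_. borel)"
  shows "(\<lambda>x. descendants n (g x) (h x)) \<in> A \<rightarrow>\<^sub>M count_space UNIV"
  using measurable_compose[OF measurable_Pair[OF assms] measurable_descendants] by simp

definition coord_law :: "nat pmf \<Rightarrow> real measure \<Rightarrow> coord \<Rightarrow> real measure" where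
  "coord_law p \<mu> j = (case j of Inl _ \<Rightarrow> distr (measure_pmf p) borel real | Inr _ \<Rightarrow> \<mu>)"

definition family_law :: "nat pmf \<Rightarrow> real measure \<Rightarrow> (coord \<Rightarrow> real) measure" where
  "family_law p \<mu> = PiM UNIV (coord_law p \<mu>)"

lemma coord_law_graft: "coord_law p \<mu> (graft i j) = coord_law p \<mu> j"
  by (auto simp: coord_law_def graft_def split: sum.splits)

context branching_random_walk
begin

sublocale step: real_distribution \<mu> by (rule step_law)

declare displacement_measurable [measurable] offspring_measurable [measurable]

abbreviation "law \<equiv> family_law p \<mu>"

lemma sets_family_law [measurable_cong]: "sets (family_law p \<mu>) = sets (PiM UNIV (\<lambda>_. borel))"
  unfolding family_law_def
  by (intro sets_PiM_cong) (auto simp: coord_law_def split: sum.splits)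

lemma space_law: "space law = UNIV"
  using sets_eq_imp_space_eq[OF sets_family_law] by (simp add: space_PiM)

lemma indep_family: "indep_vars (\<lambda>_. borel) (\<lambda>j \<omega>. family N D \<omega> j) UNIV"
proof -
  have "(\<lambda>j. case j of Inl u \<Rightarrow> (\<lambda>\<omega>. real (N u \<omega>)) | Inr (u, i) \<Rightarrow> D u i) =
      (\<lambda>j \<omega>. family N D \<omega> j)"
    by (auto simp: family_def fun_eq_iff split: sum.splits)
  with independent show ?thesis by simp
qed

lemma measurable_family_coord [measurable]: "(\<lambda>\<omega>. family N D \<omega> j) \<in> borel_measurable M"
  by (cases j) (auto simp: family_def split: prod.splits)

lemma measurable_family [measurable]: "family N D \<in> M \<rightarrow>\<^sub>M PiM UNIV (\<lambda>_. borel)"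
  using measurable_PiM_single'[of UNIV "\<lambda>j \<omega>. family N D \<omega> j" M "\<lambda>_. borel"] by auto

lemma distr_family_coord: "distr M borel (\<lambda>\<omega>. family N D \<omega> j) = coord_law p \<mu> j"
proof (cases j)
  case (Inl u)
  have "distr (distr M (count_space UNIV) (N u)) borel real = distr M borel (\<lambda>\<omega>. real (N u \<omega>))"
    by (subst distr_distr) (auto simp: comp_def)
  then show ?thesis using Inl by (simp add: offspring_distr coord_law_def family_def)
next
  case (Inr x)
  then show ?thesis
    by (cases x) (simp add: coord_law_def family_def displacement_distr)
qed

lemma indep_family_reindex:
  assumes "inj h"
  shows "indep_vars (\<lambda>_. borel) (\<lambda>j \<omega>. family N D \<omega> (h j)) UNIV"
proof -
  have "indep_vars (\<lambda>i. PiM {h i} (\<lambda>_. borel)) (\<lambda>i \<omega>. restrict (\<lambda>j. family N D \<omega> j) {h i}) UNIV"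
    using assms
    by (intro indep_vars_restrict[OF indep_family]) (auto simp: disjoint_family_on_def inj_def)
  then have "indep_vars (\<lambda>_. borel)
      (\<lambda>i \<omega>. (\<lambda>f. f (h i)) (restrict (\<lambda>j. family N D \<omega> j) {h i})) UNIV"
    by (rule indep_vars_compose2) auto
  then show ?thesis by simp
qed

text \<open>
  Self-similarity: the subtree of a child is a copy of the whole process, because \<open>graft i\<close> is injective
  and keeps offspring coordinates and displacement coordinates apart.
\<close>

lemma distr_family_graft: "distr M (PiM UNIV (\<lambda>_. borel)) (\<lambda>\<omega>. family N D \<omega> \<circ> graft i) = family_law p \<mu>"
proof -
  have "distr M (PiM UNIV (\<lambda>_. borel)) (\<lambda>\<omega>. \<lambda>j\<in>UNIV. family N D \<omega> (graft i j)) =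
      PiM UNIV (\<lambda>j. distr M borel (\<lambda>\<omega>. family N D \<omega> (graft i j)))"
    by (subst indep_vars_iff_distr_eq_PiM[symmetric]) (auto simp: indep_family_reindex inj_graft)
  then show ?thesis
    by (simp add: comp_def restrict_def distr_family_coord coord_law_graft family_law_def)
qed

lemma distr_family: "distr M (PiM UNIV (\<lambda>_. borel)) (family N D) = family_law p \<mu>"
proof -
  have "distr M (PiM UNIV (\<lambda>_. borel)) (\<lambda>\<omega>. \<lambda>j\<in>UNIV. family N D \<omega> j) =
      PiM UNIV (\<lambda>j. distr M borel (\<lambda>\<omega>. family N D \<omega> j))"
    by (subst indep_vars_iff_distr_eq_PiM[symmetric]) (auto simp: indep_family)
  then show ?thesis
    by (simp add: comp_def restrict_def distr_family_coord family_law_def)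
qed

sublocale law: prob_space "family_law p \<mu>"
  unfolding distr_family[symmetric] by (rule prob_space_distr) simp

lemma nn_integral_family:
  assumes "g \<in> borel_measurable (PiM UNIV (\<lambda>_. borel))"
  shows "(\<integral>\<^sup>+f. g f \<partial>family_law p \<mu>) = (\<integral>\<^sup>+\<omega>. g (family N D \<omega>) \<partial>M)"
  unfolding distr_family[symmetric] using assms by (subst nn_integral_distr) auto

text \<open>
  The displacement of a child and its subtree live on disjoint sets of coordinates. The two components
  have different types, whereas library independence wants one value type; hence both are first
  restricted configurations, whose joint law is a product, and are mapped to their components afterwards.
\<close>

lemma distr_subtree:
  "distr M (borel \<Otimes>\<^sub>M PiM UNIV (\<lambda>_. borel)) (\<lambda>\<omega>. (D [] i \<omega>, family N D \<omega> \<circ> graft i)) =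
   \<mu> \<Otimes>\<^sub>M family_law p \<mu>"
proof -
  let ?B = "range (graft i)" and ?A = "{Inr ([], i)} :: coord set"
  let ?RA = "\<lambda>\<omega>. restrict (\<lambda>j. family N D \<omega> j) ?A" and ?RB = "\<lambda>\<omega>. restrict (\<lambda>j. family N D \<omega> j) ?B"
  have "indep_var (PiM ?A (\<lambda>_. borel)) ?RA (PiM ?B (\<lambda>_. borel)) ?RB"
    by (rule indep_var_restrict[OF indep_family]) (auto simp: graft_def map_sum_def map_prod_def split: sum.splits)
  then have prod: "distr M (PiM ?A (\<lambda>_. borel)) ?RA \<Otimes>\<^sub>M distr M (PiM ?B (\<lambda>_. borel)) ?RB =
      distr M (PiM ?A (\<lambda>_. borel) \<Otimes>\<^sub>M PiM ?B (\<lambda>_. borel)) (\<lambda>\<omega>. (?RA \<omega>, ?RB \<omega>))"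
    unfolding indep_var_distribution_eq by simp
  have [measurable]: "?RA \<in> M \<rightarrow>\<^sub>M PiM ?A (\<lambda>_. borel)" "?RB \<in> M \<rightarrow>\<^sub>M PiM ?B (\<lambda>_. borel)"
    by (auto intro!: measurable_restrict)
  have [measurable]: "(\<lambda>f. f (Inr ([], i))) \<in> PiM ?A (\<lambda>_. borel) \<rightarrow>\<^sub>M (borel :: real measure)"
    by (rule measurable_component_singleton) auto
  have [measurable]: "(\<lambda>f. f \<circ> graft i) \<in> PiM ?B (\<lambda>_. borel) \<rightarrow>\<^sub>M PiM UNIV (\<lambda>_. borel :: real measure)"
    by (auto simp: comp_def intro!: measurable_PiM_single')
  have D: "distr (distr M (PiM ?A (\<lambda>_. borel)) ?RA) borel (\<lambda>f. f (Inr ([], i))) = \<mu>"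
    by (subst distr_distr) (measurable, simp add: comp_def family_def displacement_distr)
  have S: "distr (distr M (PiM ?B (\<lambda>_. borel)) ?RB) (PiM UNIV (\<lambda>_. borel)) (\<lambda>f. f \<circ> graft i) = family_law p \<mu>"
    unfolding distr_family_graft[of i, symmetric]
    by (subst distr_distr) (measurable, simp add: comp_def)
  have "distr (distr M (PiM ?A (\<lambda>_. borel)) ?RA) borel (\<lambda>f. f (Inr ([], i))) \<Otimes>\<^sub>M
        distr (distr M (PiM ?B (\<lambda>_. borel)) ?RB) (PiM UNIV (\<lambda>_. borel)) (\<lambda>f. f \<circ> graft i) =
      distr (distr M (PiM ?A (\<lambda>_. borel)) ?RA \<Otimes>\<^sub>M distr M (PiM ?B (\<lambda>_. borel)) ?RB)
        (borel \<Otimes>\<^sub>M PiM UNIV (\<lambda>_. borel)) (\<lambda>(f, g). (f (Inr ([], i)), g \<circ> graft i))"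
    by (rule pair_measure_distr) (simp_all add: S law.sigma_finite_measure_axioms)
  then have "\<mu> \<Otimes>\<^sub>M family_law p \<mu> =
      distr (distr M (PiM ?A (\<lambda>_. borel)) ?RA \<Otimes>\<^sub>M distr M (PiM ?B (\<lambda>_. borel)) ?RB)
        (borel \<Otimes>\<^sub>M PiM UNIV (\<lambda>_. borel)) (\<lambda>(f, g). (f (Inr ([], i)), g \<circ> graft i))"
    unfolding D S .
  also have "\<dots> = distr M (borel \<Otimes>\<^sub>M PiM UNIV (\<lambda>_. borel)) (\<lambda>\<omega>. (D [] i \<omega>, family N D \<omega> \<circ> graft i))"
    unfolding prod
    by (subst distr_distr) (measurable, simp add: comp_def, simp add: family_def)
  finally show ?thesis ..
qed

lemma nn_integral_subtree:
  assumes [measurable]: "H \<in> borel_measurable (borel \<Otimes>\<^sub>M PiM UNIV (\<lambda>_. borel))"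
  shows "(\<integral>\<^sup>+\<omega>. H (D [] i \<omega>, family N D \<omega> \<circ> graft i) \<partial>M) =
    (\<integral>\<^sup>+d. \<integral>\<^sup>+f. H (d, f) \<partial>family_law p \<mu> \<partial>\<mu>)"
proof -
  have "(\<integral>\<^sup>+\<omega>. H (D [] i \<omega>, family N D \<omega> \<circ> graft i) \<partial>M) = (\<integral>\<^sup>+z. H z \<partial>(\<mu> \<Otimes>\<^sub>M family_law p \<mu>))"
    unfolding distr_subtree[of i, symmetric] by (subst nn_integral_distr) auto
  also have "\<dots> = (\<integral>\<^sup>+d. \<integral>\<^sup>+f. H (d, f) \<partial>family_law p \<mu> \<partial>\<mu>)"
    by (rule law.nn_integral_fst[symmetric]) measurable
  finally show ?thesis .
qed

text \<open>
  The branching property, in the only form used below: the number of children and the pairs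
  (displacement, subtree) of the individual children are independent, as they are functions of pairwise
  disjoint groups of coordinates. All later recursions are instances with suitable \<open>A\<close> and \<open>H\<close>.
\<close>

lemma nn_integral_first_generation:
  fixes A :: "nat \<Rightarrow> ennreal" and H :: "nat \<Rightarrow> real \<times> (coord \<Rightarrow> real) \<Rightarrow> ennreal"
  assumes [measurable]: "\<And>i. H i \<in> borel_measurable (borel \<Otimes>\<^sub>M PiM UNIV (\<lambda>_. borel))"
  shows "(\<integral>\<^sup>+\<omega>. A (N [] \<omega>) * (\<Prod>i<k. H i (D [] i \<omega>, family N D \<omega> \<circ> graft i)) \<partial>M) =
    (\<integral>\<^sup>+j. A j \<partial>measure_pmf p) * (\<Prod>i<k. \<integral>\<^sup>+d. \<integral>\<^sup>+f. H i (d, f) \<partial>family_law p \<mu> \<partial>\<mu>)"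
proof -
  define K :: "nat option \<Rightarrow> coord set" where
    "K = (\<lambda>None \<Rightarrow> {Inl []} | Some i \<Rightarrow> insert (Inr ([], i)) (range (graft i)))"
  define G :: "nat option \<Rightarrow> (coord \<Rightarrow> real) \<Rightarrow> ennreal" where
    "G = (\<lambda>None \<Rightarrow> (\<lambda>f. A (nat \<lfloor>f (Inl [])\<rfloor>)) | Some i \<Rightarrow> (\<lambda>f. H i (f (Inr ([], i)), f \<circ> graft i)))"
  have "indep_vars (\<lambda>j. PiM (K j) (\<lambda>_. borel)) (\<lambda>j \<omega>. restrict (\<lambda>j. family N D \<omega> j) (K j)) UNIV"
    by (intro indep_vars_restrict[OF indep_family])
       (auto simp: disjoint_family_on_def K_def graft_def map_sum_def map_prod_def
          split: sum.splits option.splits)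
  moreover have "G j \<in> borel_measurable (PiM (K j) (\<lambda>_. borel))" for j
  proof (cases j)
    case None
    have "A \<in> borel_measurable (count_space UNIV)" by simp
    then show ?thesis using None by (simp add: G_def K_def)
  next
    case (Some i)
    have "(\<lambda>f. f \<circ> graft i) \<in> PiM (K (Some i)) (\<lambda>_. borel) \<rightarrow>\<^sub>M PiM UNIV (\<lambda>_. borel :: real measure)"
      by (auto simp: K_def comp_def intro!: measurable_PiM_single')
    moreover have "(\<lambda>f. f (Inr ([], i))) \<in> PiM (K (Some i)) (\<lambda>_. borel) \<rightarrow>\<^sub>M (borel :: real measure)"
      by (rule measurable_component_singleton) (auto simp: K_def)
    ultimately have "(\<lambda>f. (f (Inr ([], i)), f \<circ> graft i)) \<in> PiM (K (Some i)) (\<lambda>_. borel) \<rightarrow>\<^sub>M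
        borel \<Otimes>\<^sub>M PiM UNIV (\<lambda>_. borel :: real measure)"
      by measurable
    from measurable_compose[OF this assms] show ?thesis
      unfolding Some by (simp add: G_def)
  qed
  ultimately have "indep_vars (\<lambda>_. borel) (\<lambda>j \<omega>. G j (restrict (\<lambda>j. family N D \<omega> j) (K j))) UNIV"
    by (rule indep_vars_compose2)
  then have ind: "indep_vars (\<lambda>_. borel) (\<lambda>j \<omega>. G j (restrict (\<lambda>j. family N D \<omega> j) (K j)))
      (insert None (Some ` {..<k}))"
    by (rule indep_vars_subset) auto
  have GN: "G None (restrict (\<lambda>j. family N D \<omega> j) (K None)) = A (N [] \<omega>)" for \<omega>
    by (simp add: G_def K_def family_def)
  have GS: "G (Some i) (restrict (\<lambda>j. family N D \<omega> j) (K (Some i))) =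
      H i (D [] i \<omega>, family N D \<omega> \<circ> graft i)" for i \<omega>
    by (simp add: G_def K_def comp_def) (simp add: family_def)
  have "(\<integral>\<^sup>+\<omega>. A (N [] \<omega>) * (\<Prod>i<k. H i (D [] i \<omega>, family N D \<omega> \<circ> graft i)) \<partial>M) =
      (\<integral>\<^sup>+\<omega>. (\<Prod>j\<in>insert None (Some ` {..<k}). G j (restrict (\<lambda>j. family N D \<omega> j) (K j))) \<partial>M)"
    by (simp add: prod.reindex GN GS)
  also have "\<dots> = (\<Prod>j\<in>insert None (Some ` {..<k}). \<integral>\<^sup>+\<omega>. G j (restrict (\<lambda>j. family N D \<omega> j) (K j)) \<partial>M)"
    by (rule indep_vars_nn_integral[OF _ ind]) auto
  also have "\<dots> = (\<integral>\<^sup>+\<omega>. A (N [] \<omega>) \<partial>M) *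
      (\<Prod>i<k. \<integral>\<^sup>+d. \<integral>\<^sup>+f. H i (d, f) \<partial>family_law p \<mu> \<partial>\<mu>)"
    by (simp add: prod.reindex GN GS nn_integral_subtree)
  also have "(\<integral>\<^sup>+\<omega>. A (N [] \<omega>) \<partial>M) = (\<integral>\<^sup>+j. A j \<partial>measure_pmf p)"
    unfolding offspring_distr[of "[]", symmetric] by (subst nn_integral_distr) auto
  finally show ?thesis .
qed

end

section \<open>The random walk of a single lineage\<close>

primrec walk_law :: "real measure \<Rightarrow> nat \<Rightarrow> real measure" where
  "walk_law \<mu> 0 = return borel 0"
| "walk_law \<mu> (Suc n) = convolution \<mu> (walk_law \<mu> n)"

definition tail :: "real measure \<Rightarrow> nat \<Rightarrow> real \<Rightarrow> real" where
  "tail \<mu> n y = measure (walk_law \<mu> n) {y..}"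

context real_distribution
begin

lemma real_distribution_walk_law: "real_distribution (walk_law M n)"
proof (induction n)
  case 0
  show ?case
    by (auto simp: real_distribution_def real_distribution_axioms_def intro!: prob_space_return)
next
  case (Suc n)
  interpret W: real_distribution "walk_law M n" by (rule Suc)
  interpret pair_prob_space M "walk_law M n" ..
  have "prob_space (convolution M (walk_law M n))"
    unfolding convolution_def by (rule prob_space_distr) measurable
  then show ?case
    by (auto simp: real_distribution_def real_distribution_axioms_def)
qed

lemma sets_walk_law [measurable_cong, simp]: "sets (walk_law M n) = sets borel"
  using real_distribution_walk_law by (simp add: real_distribution_def real_distribution_axioms_def)

lemma prob_space_walk_law: "prob_space (walk_law M n)"
  using real_distribution_walk_law by (simp add: real_distribution_def)

lemma finite_measure_walk_law: "finite_measure (walk_law M n)"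
  using prob_space_walk_law by (simp add: prob_space.finite_measure)

lemma ennreal_tail: "ennreal (tail M n y) = emeasure (walk_law M n) {y..}"
  unfolding tail_def by (simp add: finite_measure.emeasure_eq_measure[OF finite_measure_walk_law])

lemma tail_nonneg: "0 \<le> tail M n y" and tail_le_1: "tail M n y \<le> 1"
  by (auto simp: tail_def prob_space.prob_le_1[OF prob_space_walk_law])

lemma tail_antimono: "y \<le> z \<Longrightarrow> tail M n z \<le> tail M n y"
  unfolding tail_def by (rule finite_measure.finite_measure_mono[OF finite_measure_walk_law]) auto

lemma tail_0: "tail M 0 y = (if y \<le> 0 then 1 else 0)"
  by (simp add: tail_def measure_return)

lemma measurable_tail [measurable]: "tail M n \<in> borel_measurable borel"
proof -
  have "mono (\<lambda>y. - tail M n y)" by (intro monoI) (simp add: tail_antimono)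
  then have "(\<lambda>y. - tail M n y) \<in> borel_measurable borel" by (rule borel_measurable_mono)
  then have "(\<lambda>y. - (- tail M n y)) \<in> borel_measurable borel" by (rule borel_measurable_uminus)
  then show ?thesis by simp
qed

lemma nn_integral_walk_law_Suc:
  assumes [measurable]: "g \<in> borel_measurable borel"
  shows "(\<integral>\<^sup>+s. g s \<partial>walk_law M (Suc n)) = (\<integral>\<^sup>+d. \<integral>\<^sup>+s. g (d + s) \<partial>walk_law M n \<partial>M)"
  using finite_measure_walk_law by (simp add: nn_integral_convolution finite_measure_axioms)

lemma tail_Suc: "ennreal (tail M (Suc n) y) = (\<integral>\<^sup>+d. ennreal (tail M n (y - d)) \<partial>M)"
proof -
  have "ennreal (tail M (Suc n) y) = (\<integral>\<^sup>+s. indicator {y..} s \<partial>walk_law M (Suc n))"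
    unfolding ennreal_tail by (subst nn_integral_indicator) (auto simp del: walk_law.simps)
  also have "\<dots> = (\<integral>\<^sup>+d. \<integral>\<^sup>+s. indicator {y..} (d + s) \<partial>walk_law M n \<partial>M)"
    by (rule nn_integral_walk_law_Suc) auto
  also have "\<dots> = (\<integral>\<^sup>+d. \<integral>\<^sup>+s. indicator {y - d..} s \<partial>walk_law M n \<partial>M)"
    by (intro nn_integral_cong) (auto split: split_indicator)
  also have "\<dots> = (\<integral>\<^sup>+d. ennreal (tail M n (y - d)) \<partial>M)"
    unfolding ennreal_tail by (intro nn_integral_cong) (subst nn_integral_indicator, auto)
  finally show ?thesis .
qed

lemma walk_law_mgf:
  "(\<integral>\<^sup>+s. ennreal (exp (t * s)) \<partial>walk_law M n) = (\<integral>\<^sup>+d. ennreal (exp (t * d)) \<partial>M) ^ n"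
proof (induction n)
  case 0
  show ?case by (simp add: nn_integral_return)
next
  case (Suc n)
  interpret W: real_distribution "walk_law M n" by (rule real_distribution_walk_law)
  have "(\<integral>\<^sup>+s. ennreal (exp (t * s)) \<partial>walk_law M (Suc n)) =
      (\<integral>\<^sup>+d. \<integral>\<^sup>+s. ennreal (exp (t * d)) * ennreal (exp (t * s)) \<partial>walk_law M n \<partial>M)"
    by (subst nn_integral_walk_law_Suc) (auto simp: ring_distribs exp_add ennreal_mult)
  also have "\<dots> = (\<integral>\<^sup>+d. ennreal (exp (t * d)) \<partial>M) * (\<integral>\<^sup>+s. ennreal (exp (t * s)) \<partial>walk_law M n)"
    by (simp add: nn_integral_cmult nn_integral_multc)
  finally show ?case by (simp add: Suc)
qed

end

section \<open>Moments of the number of descendants\<close>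

text \<open>
  A Paley--Zygmund inequality in which an exponential moment replaces the second moment: a nonnegative variable
  reaches half its mean with probability of order (mean)\<open>\<^sup>2\<close> / (second moment), and \<open>exp (\<beta> * X)\<close> controls \<open>X\<^sup>2\<close>.
  The reason is that \<open>X\<close> is at most \<open>e / 2\<close>, plus \<open>A\<close> where \<open>X \<ge> e / 2\<close>, plus a multiple of \<open>exp (\<beta> * X)\<close>.
\<close>

lemma (in prob_space) paley_zygmund_exp:
  fixes X :: "'a \<Rightarrow> real"
  assumes [measurable]: "X \<in> borel_measurable M" and nonneg: "\<And>\<omega>. 0 \<le> X \<omega>"
    and e: "0 < e" "ennreal e \<le> (\<integral>\<^sup>+\<omega>. X \<omega> \<partial>M)"
    and \<beta>: "0 < \<beta>" and K: "0 < K" "(\<integral>\<^sup>+\<omega>. exp (\<beta> * X \<omega>) \<partial>M) \<le> ennreal K"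
  shows "e\<^sup>2 * \<beta>\<^sup>2 / (32 * K) \<le> prob {\<omega> \<in> space M. e / 2 \<le> X \<omega>}"
proof -
  \<comment> \<open>The truncation level for which the part of the mean above it is at most \<open>e / 4\<close>.\<close>
  define A where "A = 8 * K / (e * \<beta>\<^sup>2)"
  define E where "E = {\<omega> \<in> space M. e / 2 \<le> X \<omega>}"
  have A: "0 < A" using e \<beta> K by (simp add: A_def)
  have [measurable]: "E \<in> events" unfolding E_def by measurable
  have pt: "X \<omega> \<le> e / 2 + A * indicator E \<omega> + 2 / (A * \<beta>\<^sup>2) * exp (\<beta> * X \<omega>)" if "\<omega> \<in> space M" for \<omega>
  proof -
    define Z where "Z = 2 / (A * \<beta>\<^sup>2) * exp (\<beta> * X \<omega>)"
    have pos: "0 \<le> Z" using A by (simp add: Z_def)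
    show ?thesis unfolding Z_def[symmetric]
    proof (cases "X \<omega> < e / 2 \<or> X \<omega> \<le> A")
      case True
      with that pos e A show "X \<omega> \<le> e / 2 + A * indicator E \<omega> + Z"
        by (auto simp: E_def split: split_indicator)
    next
      case False
      have "1 + \<beta> * X \<omega> + (\<beta> * X \<omega>)\<^sup>2 / 2 \<le> exp (\<beta> * X \<omega>)"
        using \<beta> nonneg[of \<omega>] by (intro exp_lower_Taylor_quadratic) auto
      then have "(\<beta> * X \<omega>)\<^sup>2 / 2 \<le> exp (\<beta> * X \<omega>)"
        using mult_nonneg_nonneg[of \<beta> "X \<omega>"] \<beta> nonneg[of \<omega>] by linarith
      then have "(X \<omega>)\<^sup>2 / A \<le> 2 / (A * \<beta>\<^sup>2) * exp (\<beta> * X \<omega>)"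
        using \<beta> A by (simp add: field_simps)
      moreover have "X \<omega> \<le> (X \<omega>)\<^sup>2 / A"
        using False A nonneg[of \<omega>] by (simp add: field_simps power2_eq_square mult_right_mono)
      ultimately show "X \<omega> \<le> e / 2 + A * indicator E \<omega> + Z"
        using e A by (auto simp: Z_def split: split_indicator)
    qed
  qed
  have "ennreal e \<le> (\<integral>\<^sup>+\<omega>. ennreal (e / 2 + A * indicator E \<omega> + 2 / (A * \<beta>\<^sup>2) * exp (\<beta> * X \<omega>)) \<partial>M)"
    using pt by (intro order.trans[OF e(2)] nn_integral_mono ennreal_leI) auto
  also have "\<dots> = (\<integral>\<^sup>+\<omega>. ennreal (e / 2) + ennreal A * indicator E \<omega> +
      ennreal (2 / (A * \<beta>\<^sup>2)) * ennreal (exp (\<beta> * X \<omega>)) \<partial>M)"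
  proof (rule nn_integral_cong)
    fix \<omega>
    have "0 \<le> 2 / (A * \<beta>\<^sup>2)" using A by simp
    then show "ennreal (e / 2 + A * indicator E \<omega> + 2 / (A * \<beta>\<^sup>2) * exp (\<beta> * X \<omega>)) =
        ennreal (e / 2) + ennreal A * indicator E \<omega> + ennreal (2 / (A * \<beta>\<^sup>2)) * ennreal (exp (\<beta> * X \<omega>))"
      using e A
      by (subst ennreal_mult[symmetric])
         (auto simp: ennreal_plus[symmetric] simp del: ennreal_plus split: split_indicator)
  qed
  also have "\<dots> = ennreal (e / 2) + ennreal A * emeasure M E +
      ennreal (2 / (A * \<beta>\<^sup>2)) * (\<integral>\<^sup>+\<omega>. exp (\<beta> * X \<omega>) \<partial>M)"
    by (simp add: nn_integral_add nn_integral_cmult emeasure_space_1)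
  also have "\<dots> \<le> ennreal (e / 2) + ennreal A * ennreal (prob E) + ennreal (2 / (A * \<beta>\<^sup>2)) * ennreal K"
    using K by (intro add_mono mult_left_mono) (auto simp: emeasure_eq_measure)
  also have "\<dots> = ennreal (e / 2 + A * prob E + 2 / (A * \<beta>\<^sup>2) * K)"
    using e A K by (simp add: ennreal_plus ennreal_mult' measure_nonneg del: times_divide_eq_left)
  finally have "e \<le> e / 2 + A * prob E + 2 / (A * \<beta>\<^sup>2) * K"
    using e A K by (subst (asm) ennreal_le_iff) (auto simp: measure_nonneg)
  moreover have "2 / (A * \<beta>\<^sup>2) * K = e / 4"
    using e \<beta> K by (simp add: A_def field_simps)
  ultimately have "e / 4 \<le> A * prob E" by simp
  then show ?thesis
    using e \<beta> K unfolding E_def[symmetric] by (simp add: A_def field_simps power2_eq_square)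
qed

context branching_random_walk
begin

lemma emeasure_step_UNIV [simp]: "emeasure \<mu> UNIV = 1"
  using step.emeasure_space_1 by simp

lemma descendants_family_Suc:
  "descendants (Suc n) y (family N D \<omega>) =
    (\<Sum>i<N [] \<omega>. descendants n (y - D [] i \<omega>) (family N D \<omega> \<circ> graft i))"
proof -
  have "nat \<lfloor>family N D \<omega> (Inl [])\<rfloor> = N [] \<omega>" "family N D \<omega> (Inr ([], i)) = D [] i \<omega>" for i
    by (simp_all add: family_def)
  then show ?thesis by (simp only: descendants.simps)
qed

text \<open>
  Many-to-one: on average there are \<open>m ^ n\<close> particles, each of them at the position of a random walk.
\<close>

lemma nn_integral_descendants:
  "(\<integral>\<^sup>+f. real (descendants n y f) \<partial>law) =
    (\<integral>\<^sup>+k. ennreal (real k) \<partial>measure_pmf p) ^ n * ennreal (tail \<mu> n y)"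
proof (induction n arbitrary: y)
  case 0
  show ?case by (simp add: step.tail_0 law.emeasure_space_1)
next
  case (Suc n)
  define g where "g i \<omega> = (if i < N [] \<omega> then 1 else 0) *
      ennreal (real (descendants n (y - D [] i \<omega>) (family N D \<omega> \<circ> graft i)))" for i \<omega>
  have [measurable]: "(\<lambda>\<omega>. family N D \<omega> \<circ> graft i) \<in> M \<rightarrow>\<^sub>M PiM UNIV (\<lambda>_. borel)" for i
    using measurable_compose[OF measurable_family measurable_graft[of i]] by simp
  have [measurable]: "g i \<in> borel_measurable M" for i
    unfolding g_def by measurable
  have sum: "ennreal (real (descendants (Suc n) y (family N D \<omega>))) = (\<Sum>i. g i \<omega>)" for \<omega>
  proof -
    have "(\<Sum>i. g i \<omega>) = (\<Sum>i<N [] \<omega>. g i \<omega>)"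
      by (rule suminf_finite) (auto simp: g_def)
    also have "\<dots> = ennreal (real (descendants (Suc n) y (family N D \<omega>)))"
      unfolding descendants_family_Suc by (simp add: g_def)
    finally show ?thesis ..
  qed
  have gi: "(\<integral>\<^sup>+\<omega>. g i \<omega> \<partial>M) = (\<integral>\<^sup>+k. (if i < k then 1 else 0) \<partial>measure_pmf p) *
      (\<integral>\<^sup>+d. \<integral>\<^sup>+f. real (descendants n (y - d) f) \<partial>law \<partial>\<mu>)" for i
  proof -
    \<comment> \<open>Only the child \<open>i\<close> matters; the other factors are set to one.\<close>
    define H where "H j z = (if j = i then ennreal (real (descendants n (y - fst z) (snd z))) else 1)"
      for j :: nat and z
    have H: "H j \<in> borel_measurable (borel \<Otimes>\<^sub>M PiM UNIV (\<lambda>_. borel))" for j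
      unfolding H_def by measurable
    have "(\<integral>\<^sup>+\<omega>. g i \<omega> \<partial>M) = (\<integral>\<^sup>+\<omega>. (if i < N [] \<omega> then 1 else 0) *
        (\<Prod>j<Suc i. H j (D [] j \<omega>, family N D \<omega> \<circ> graft j)) \<partial>M)"
      by (simp add: g_def H_def)
    also have "\<dots> = (\<integral>\<^sup>+k. (if i < k then 1 else 0) \<partial>measure_pmf p) *
        (\<Prod>j<Suc i. \<integral>\<^sup>+d. \<integral>\<^sup>+f. H j (d, f) \<partial>law \<partial>\<mu>)"
      by (rule nn_integral_first_generation[OF H])
    also have "(\<Prod>j<Suc i. \<integral>\<^sup>+d. \<integral>\<^sup>+f. H j (d, f) \<partial>law \<partial>\<mu>) =
        (\<integral>\<^sup>+d. \<integral>\<^sup>+f. real (descendants n (y - d) f) \<partial>law \<partial>\<mu>)"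
      by (simp add: H_def law.emeasure_space_1 step.emeasure_space_1)
    finally show ?thesis .
  qed
  have mean: "(\<Sum>i. \<integral>\<^sup>+k. (if i < k then 1 else 0) \<partial>measure_pmf p) = (\<integral>\<^sup>+k. ennreal (real k) \<partial>measure_pmf p)"
  proof -
    have "(\<Sum>i. if i < k then 1 else 0) = ennreal (real k)" for k :: nat
    proof -
      have "(\<Sum>i. if i < k then 1 else 0 :: ennreal) = (\<Sum>i<k. if i < k then 1 else 0)"
        by (rule suminf_finite) auto
      then show ?thesis by (simp add: ennreal_of_nat_eq_real_of_nat)
    qed
    then show ?thesis by (subst nn_integral_suminf[symmetric]) auto
  qed
  have tail: "(\<integral>\<^sup>+d. \<integral>\<^sup>+f. real (descendants n (y - d) f) \<partial>law \<partial>\<mu>) =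
      (\<integral>\<^sup>+k. ennreal (real k) \<partial>measure_pmf p) ^ n * ennreal (tail \<mu> (Suc n) y)"
    unfolding Suc step.tail_Suc by (rule nn_integral_cmult) measurable
  have "(\<integral>\<^sup>+f. real (descendants (Suc n) y f) \<partial>law) =
      (\<integral>\<^sup>+\<omega>. real (descendants (Suc n) y (family N D \<omega>)) \<partial>M)"
    by (rule nn_integral_family) measurable
  also have "\<dots> = (\<Sum>i. \<integral>\<^sup>+\<omega>. g i \<omega> \<partial>M)"
    unfolding sum by (rule nn_integral_suminf) auto
  also have "\<dots> = (\<Sum>i. \<integral>\<^sup>+k. (if i < k then 1 else 0) \<partial>measure_pmf p) *
      (\<integral>\<^sup>+d. \<integral>\<^sup>+f. real (descendants n (y - d) f) \<partial>law \<partial>\<mu>)"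
    unfolding gi by simp
  finally show ?case unfolding mean tail by (simp add: mult.assoc)
qed

definition exp_moment :: "real \<Rightarrow> nat \<Rightarrow> real \<Rightarrow> ennreal" where
  "exp_moment \<beta> n y = (\<integral>\<^sup>+f. exp (\<beta> * real (descendants n y f)) \<partial>law)"

lemma exp_moment_Suc:
  "exp_moment \<beta> (Suc n) y = (\<integral>\<^sup>+k. (\<integral>\<^sup>+d. exp_moment \<beta> n (y - d) \<partial>\<mu>) ^ k \<partial>measure_pmf p)"
proof -
  define h where "h = (\<integral>\<^sup>+d. exp_moment \<beta> n (y - d) \<partial>\<mu>)"
  define H where "H z = ennreal (exp (\<beta> * real (descendants n (y - fst z) (snd z))))" for z
  have H[measurable]: "H \<in> borel_measurable (borel \<Otimes>\<^sub>M PiM UNIV (\<lambda>_. borel))"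
    unfolding H_def by measurable
  have [measurable]: "(\<lambda>\<omega>. family N D \<omega> \<circ> graft i) \<in> M \<rightarrow>\<^sub>M PiM UNIV (\<lambda>_. borel)" for i
    using measurable_compose[OF measurable_family measurable_graft[of i]] by simp
  define g where "g k \<omega> = (if N [] \<omega> = k then 1 else 0) *
      (\<Prod>i<k. H (D [] i \<omega>, family N D \<omega> \<circ> graft i))" for k \<omega>
  have [measurable]: "g k \<in> borel_measurable M" for k
    unfolding g_def by measurable
  have sum: "ennreal (exp (\<beta> * real (descendants (Suc n) y (family N D \<omega>)))) = (\<Sum>k. g k \<omega>)" for \<omega>
  proof -
    have "(\<Sum>k. g k \<omega>) = (\<Sum>k\<in>{N [] \<omega>}. g k \<omega>)"
      by (rule suminf_finite) (auto simp: g_def)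
    also have "\<dots> = ennreal (exp (\<beta> * real (descendants (Suc n) y (family N D \<omega>))))"
      unfolding descendants_family_Suc by (simp add: g_def H_def sum_distrib_left exp_sum prod_ennreal)
    finally show ?thesis ..
  qed
  have gk: "(\<integral>\<^sup>+\<omega>. g k \<omega> \<partial>M) = (\<integral>\<^sup>+j. (if j = k then 1 else 0) \<partial>measure_pmf p) * h ^ k" for k
    unfolding g_def using nn_integral_first_generation[of "\<lambda>_. H" "\<lambda>j. if j = k then 1 else 0" k]
    by (simp add: H h_def exp_moment_def H_def)
  have "exp_moment \<beta> (Suc n) y =
      (\<integral>\<^sup>+\<omega>. ennreal (exp (\<beta> * real (descendants (Suc n) y (family N D \<omega>)))) \<partial>M)"
    unfolding exp_moment_def by (rule nn_integral_family) measurable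
  also have "\<dots> = (\<Sum>k. \<integral>\<^sup>+\<omega>. g k \<omega> \<partial>M)"
    unfolding sum by (rule nn_integral_suminf) auto
  also have "\<dots> = (\<Sum>k. \<integral>\<^sup>+j. (if j = k then 1 else 0) * h ^ k \<partial>measure_pmf p)"
    unfolding gk by (simp add: nn_integral_multc)
  also have "\<dots> = (\<integral>\<^sup>+j. (\<Sum>k. (if j = k then 1 else 0) * h ^ k) \<partial>measure_pmf p)"
    by (rule nn_integral_suminf[symmetric]) auto
  also have "\<dots> = (\<integral>\<^sup>+j. h ^ j \<partial>measure_pmf p)"
  proof (rule nn_integral_cong)
    fix j
    have "(\<Sum>k. (if j = k then 1 else 0) * h ^ k) = (\<Sum>k\<in>{j}. (if j = k then 1 else 0) * h ^ k)"
      by (rule suminf_finite) auto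
    then show "(\<Sum>k. (if j = k then 1 else 0) * h ^ k) = h ^ j" by simp
  qed
  finally show ?thesis by (simp add: h_def)
qed

text \<open>
  The key upper estimate. Up to the factors \<open>\<rho>\<close>, the exponent on the right is \<open>\<beta>\<close> times the expected count.
  As long as this exponent is at most \<open>\<delta>\<close>, the function \<open>exp\<close> is almost linear, so that the logarithm of the
  exponential moment obeys the recursion of the mean, with \<open>m\<close> replaced by a larger \<open>\<rho>\<close>:
  \<open>1 + \<delta>\<close> pays for linearizing the moment of one subtree, \<open>\<tau>\<close> for that of the offspring number. Smallness is
  needed only where a particle can be: with \<open>r\<close> generations left out of \<open>n\<close>, steps of at most \<open>L\<close> leave at
  least \<open>Y + r * L\<close> to cover. The factor \<open>2\<close> in \<open>s \<le> 2 * \<delta>\<close> absorbs \<open>1 + \<delta>\<close>.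
\<close>

lemma exp_moment_le:
  fixes \<beta> \<rho> \<tau> \<delta> L Y :: real
  assumes bounded: "AE d in \<mu>. d \<le> L"
    and \<beta>: "0 \<le> \<beta>" and \<delta>: "0 \<le> \<delta>" "\<delta> \<le> 1" and \<rho>: "0 \<le> \<tau>" "(1 + \<delta>) * \<tau> \<le> \<rho>"
    and offspring: "\<And>s. 0 \<le> s \<Longrightarrow> s \<le> 2 * \<delta> \<Longrightarrow>
      (\<integral>\<^sup>+k. ennreal (exp s) ^ k \<partial>measure_pmf p) \<le> ennreal (exp (\<tau> * s))"
    and small: "\<And>j. j \<le> n \<Longrightarrow> \<beta> * \<rho> ^ j * tail \<mu> j (Y + real j * L) \<le> \<delta>"
    and r: "r \<le> n" "Y + real r * L \<le> y"
  shows "exp_moment \<beta> r y \<le> ennreal (exp (\<beta> * \<rho> ^ r * tail \<mu> r y))"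
  using r
proof (induction r arbitrary: y)
  case 0
  show ?case by (auto simp: exp_moment_def step.tail_0 law.emeasure_space_1)
next
  case (Suc r)
  have \<rho>_nonneg: "0 \<le> \<rho>" using \<rho> \<delta> by (smt (verit) mult_nonneg_nonneg)
  have nn: "0 \<le> \<beta> * \<rho> ^ r" using \<beta> \<rho>_nonneg by simp
  define F where "F = \<beta> * \<rho> ^ r * tail \<mu> (Suc r) y"
  have F0: "0 \<le> F" using nn step.tail_nonneg by (simp add: F_def)
  have le: "exp_moment \<beta> r (y - d) \<le> ennreal (1 + (1 + \<delta>) * (\<beta> * \<rho> ^ r * tail \<mu> r (y - d)))"
    and le': "\<beta> * \<rho> ^ r * tail \<mu> r (y - d) \<le> \<delta>" if "d \<le> L" for d
  proof -
    define u where "u = \<beta> * \<rho> ^ r * tail \<mu> r (y - d)"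
    have yd: "Y + real r * L \<le> y - d" using Suc.prems that by (simp add: algebra_simps)
    have "u \<le> \<beta> * \<rho> ^ r * tail \<mu> r (Y + real r * L)"
      unfolding u_def using yd nn by (intro mult_left_mono step.tail_antimono) auto
    also have "\<dots> \<le> \<delta>" using small Suc.prems by simp
    finally have u: "u \<le> \<delta>" .
    have u0: "0 \<le> u" using nn step.tail_nonneg by (simp add: u_def)
    \<comment> \<open>The linearization of \<open>exp\<close> below \<open>\<delta>\<close>.\<close>
    have "exp u \<le> 1 + u + u\<^sup>2" using u u0 \<delta> by (intro exp_bound) auto
    also have "\<dots> \<le> 1 + (1 + \<delta>) * u"
      using mult_right_mono[OF u u0] by (simp add: power2_eq_square algebra_simps)
    finally have "exp u \<le> 1 + (1 + \<delta>) * u" .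
    moreover have "exp_moment \<beta> r (y - d) \<le> ennreal (exp u)"
      unfolding u_def using Suc.prems yd by (intro Suc.IH) auto
    ultimately show "exp_moment \<beta> r (y - d) \<le> ennreal (1 + (1 + \<delta>) * (\<beta> * \<rho> ^ r * tail \<mu> r (y - d)))"
      unfolding u_def by (meson ennreal_leI order_trans)
    show "\<beta> * \<rho> ^ r * tail \<mu> r (y - d) \<le> \<delta>" using u by (simp add: u_def)
  qed
  have int: "(\<integral>\<^sup>+d. ennreal (\<beta> * \<rho> ^ r * tail \<mu> r (y - d)) \<partial>\<mu>) = ennreal F"
  proof -
    have "(\<integral>\<^sup>+d. ennreal (\<beta> * \<rho> ^ r * tail \<mu> r (y - d)) \<partial>\<mu>) =
        (\<integral>\<^sup>+d. ennreal (\<beta> * \<rho> ^ r) * ennreal (tail \<mu> r (y - d)) \<partial>\<mu>)"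
      using nn by (intro nn_integral_cong) (simp add: ennreal_mult step.tail_nonneg)
    also have "\<dots> = ennreal F"
      using nn by (subst nn_integral_cmult) (auto simp: F_def ennreal_mult step.tail_nonneg step.tail_Suc)
    finally show ?thesis .
  qed
  have "ennreal F \<le> (\<integral>\<^sup>+d. ennreal \<delta> \<partial>\<mu>)"
    unfolding int[symmetric] using bounded le' by (intro nn_integral_mono_AE) (auto intro: ennreal_leI)
  then have F: "F \<le> \<delta>" using \<delta> by (simp add: step.emeasure_space_1)
  have "(\<integral>\<^sup>+d. exp_moment \<beta> r (y - d) \<partial>\<mu>) \<le>
      (\<integral>\<^sup>+d. ennreal 1 + ennreal (1 + \<delta>) * ennreal (\<beta> * \<rho> ^ r * tail \<mu> r (y - d)) \<partial>\<mu>)"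
  proof (rule nn_integral_mono_AE)
    show "AE d in \<mu>. exp_moment \<beta> r (y - d) \<le>
        ennreal 1 + ennreal (1 + \<delta>) * ennreal (\<beta> * \<rho> ^ r * tail \<mu> r (y - d))"
      using bounded
    proof eventually_elim
      case (elim d)
      have "0 \<le> \<beta> * \<rho> ^ r * tail \<mu> r (y - d)" using nn step.tail_nonneg by simp
      then show ?case
        using le[OF elim] \<delta> by (simp add: ennreal_plus[symmetric] ennreal_mult'[symmetric] del: ennreal_plus ennreal_1)
    qed
  qed
  also have "\<dots> = ennreal (1 + (1 + \<delta>) * F)"
  proof -
    have "ennreal (1 + (1 + \<delta>) * F) = 1 + ennreal (1 + \<delta>) * ennreal F"
      using \<delta> F0 by (subst ennreal_plus) (auto simp: ennreal_mult')
    then show ?thesis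
      by (subst nn_integral_add, simp, simp, subst nn_integral_cmult, simp) (simp add: int)
  qed
  also have "\<dots> \<le> ennreal (exp ((1 + \<delta>) * F))"
    by (intro ennreal_leI exp_ge_add_one_self)
  finally have *: "(\<integral>\<^sup>+d. exp_moment \<beta> r (y - d) \<partial>\<mu>) \<le> ennreal (exp ((1 + \<delta>) * F))" .
  have "(1 + \<delta>) * F \<le> 2 * \<delta>" using \<delta> F F0 by (intro mult_mono) auto
  have "exp_moment \<beta> (Suc r) y \<le> (\<integral>\<^sup>+k. ennreal (exp ((1 + \<delta>) * F)) ^ k \<partial>measure_pmf p)"
    unfolding exp_moment_Suc by (intro nn_integral_mono power_mono *) auto
  also have "\<dots> \<le> ennreal (exp (\<tau> * ((1 + \<delta>) * F)))"
    using \<delta> F0 \<open>(1 + \<delta>) * F \<le> 2 * \<delta>\<close> by (intro offspring) auto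
  also have "\<dots> \<le> ennreal (exp (\<rho> * F))"
    using mult_right_mono[OF \<rho>(2) F0] by (intro ennreal_leI) (simp add: algebra_simps)
  finally show ?case by (simp add: F_def algebra_simps)
qed

lemma descendants_antimono: "y \<le> z \<Longrightarrow> descendants n z f \<le> descendants n y f"
  by (induction n arbitrary: y z f) (auto intro!: sum_mono)

definition success :: "nat \<Rightarrow> real \<Rightarrow> real \<Rightarrow> real" where
  "success n y w = measure law {f \<in> space law. w \<le> real (descendants n y f)}"

text \<open>
  One generation of the forcing strategy: the root has \<open>b\<close> children, each of them moves by at least \<open>l\<close>, and
  each of their subtrees contributes \<open>w\<close> particles.
\<close>

lemma success_Suc:
  "pmf p b * (measure \<mu> {l..} * success n y w) ^ b \<le> success (Suc n) (y + l) (real b * w)"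
proof -
  define H where "H z = indicator {l..} (fst z) *
      (indicator {f \<in> space law. w \<le> real (descendants n y f)} (snd z) :: ennreal)" for z
  have H: "H \<in> borel_measurable (borel \<Otimes>\<^sub>M PiM UNIV (\<lambda>_. borel))"
    unfolding H_def space_law by measurable
  have int: "(\<integral>\<^sup>+d. \<integral>\<^sup>+f. H (d, f) \<partial>law \<partial>\<mu>) = ennreal (measure \<mu> {l..} * success n y w)"
  proof -
    have "(\<integral>\<^sup>+d. \<integral>\<^sup>+f. H (d, f) \<partial>law \<partial>\<mu>) =
        (\<integral>\<^sup>+d. indicator {l..} d * ennreal (success n y w) \<partial>\<mu>)"
      unfolding H_def success_def fst_conv snd_conv
      by (intro nn_integral_cong, subst nn_integral_cmult)
         (simp_all add: law.emeasure_eq_measure)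
    also have "\<dots> = ennreal (measure \<mu> {l..} * success n y w)"
      by (subst nn_integral_multc)
         (auto simp: step.emeasure_eq_measure ennreal_mult success_def)
    finally show ?thesis .
  qed
  have "ennreal (pmf p b * (measure \<mu> {l..} * success n y w) ^ b) =
      (\<integral>\<^sup>+j. indicator {b} j \<partial>measure_pmf p) * (\<Prod>i<b. \<integral>\<^sup>+d. \<integral>\<^sup>+f. H (d, f) \<partial>law \<partial>\<mu>)"
    unfolding int
    by (subst ennreal_mult) (simp_all add: ennreal_power success_def emeasure_pmf_single)
  also have "\<dots> = (\<integral>\<^sup>+\<omega>. indicator {b} (N [] \<omega>) * (\<Prod>i<b. H (D [] i \<omega>, family N D \<omega> \<circ> graft i)) \<partial>M)"
    by (rule nn_integral_first_generation[symmetric]) (rule H)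
  also have "\<dots> \<le> (\<integral>\<^sup>+\<omega>. indicator {f \<in> space law. real b * w \<le> real (descendants (Suc n) (y + l) f)}
      (family N D \<omega>) \<partial>M)"
  proof (rule nn_integral_mono)
    fix \<omega>
    show "indicator {b} (N [] \<omega>) * (\<Prod>i<b. H (D [] i \<omega>, family N D \<omega> \<circ> graft i)) \<le>
      indicator {f \<in> space law. real b * w \<le> real (descendants (Suc n) (y + l) f)} (family N D \<omega>)"
    proof (cases "N [] \<omega> = b \<and> (\<forall>i<b. H (D [] i \<omega>, family N D \<omega> \<circ> graft i) \<noteq> 0)")
      case True
      have "w \<le> real (descendants n (y + l - D [] i \<omega>) (family N D \<omega> \<circ> graft i))" if "i < b" for i
      proof -
        have "l \<le> D [] i \<omega>" "w \<le> real (descendants n y (family N D \<omega> \<circ> graft i))"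
          using True that by (auto simp: H_def space_law split: split_indicator_asm)
        moreover have "descendants n y (family N D \<omega> \<circ> graft i) \<le>
            descendants n (y + l - D [] i \<omega>) (family N D \<omega> \<circ> graft i)"
          using \<open>l \<le> D [] i \<omega>\<close> by (intro descendants_antimono) auto
        ultimately show ?thesis by linarith
      qed
      then have "(\<Sum>i<b. w) \<le> real (descendants (Suc n) (y + l) (family N D \<omega>))"
        unfolding descendants_family_Suc of_nat_sum conjunct1[OF True] by (intro sum_mono) simp
      moreover have "(\<Prod>i<b. H (D [] i \<omega>, family N D \<omega> \<circ> graft i)) \<le> 1"
        by (intro prod_le_1) (auto simp: H_def split: split_indicator)
      ultimately show ?thesis using True by (auto simp: space_law)
    next
      case False
      then have "indicator {b} (N [] \<omega>) * (\<Prod>i<b. H (D [] i \<omega>, family N D \<omega> \<circ> graft i)) = 0"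
        by (auto simp: prod_zero_iff)
      then show ?thesis by (simp only: zero_le)
    qed
  qed
  also have "\<dots> = ennreal (success (Suc n) (y + l) (real b * w))"
  proof -
    have "(\<integral>\<^sup>+\<omega>. indicator {f \<in> space law. real b * w \<le> real (descendants (Suc n) (y + l) f)} (family N D \<omega>) \<partial>M) =
      (\<integral>\<^sup>+f. indicator {f \<in> space law. real b * w \<le> real (descendants (Suc n) (y + l) f)} f \<partial>law)"
      unfolding space_law by (rule nn_integral_family[symmetric]) measurable
    also have "\<dots> = ennreal (success (Suc n) (y + l) (real b * w))"
      unfolding success_def by (subst nn_integral_indicator) (auto simp: law.emeasure_eq_measure simp del: descendants.simps)
    finally show ?thesis .
  qed
  finally show ?thesis by (simp add: success_def)
qed

text \<open>
  After \<open>k\<close> forced generations there are \<open>b ^ k\<close> subtrees. The forced events number at most \<open>b ^ k - 1\<close> groups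
  of cost \<open>\<kappa> = pmf p b * measure \<mu> {l..} ^ b\<close>: for \<open>b \<ge> 2\<close> one has \<open>1 + b + \<dots> + b ^ (k - 1) \<le> b ^ k - 1\<close>.
\<close>

lemma success_iterate:
  assumes b: "2 \<le> b"
  shows "success r y w ^ (b ^ k) * (pmf p b * measure \<mu> {l..} ^ b) ^ (b ^ k - 1) \<le>
    success (k + r) (y + real k * l) (real b ^ k * w)"
proof (induction k)
  case 0
  show ?case by simp
next
  case (Suc k)
  define \<pi> where "\<pi> = success r y w"
  define \<kappa> where "\<kappa> = pmf p b * measure \<mu> {l..} ^ b"
  have \<pi>: "0 \<le> \<pi>" by (simp add: \<pi>_def success_def)
  have \<kappa>: "0 \<le> \<kappa>" "\<kappa> \<le> 1"
    using pmf_le_1[of p b] by (auto simp: \<kappa>_def intro!: mult_le_one power_le_one)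
  have pos: "1 \<le> b ^ k" using b by simp
  have "\<pi> ^ (b ^ Suc k) * \<kappa> ^ (b ^ Suc k - 1) \<le> \<pi> ^ (b ^ Suc k) * \<kappa> ^ (1 + (b ^ k - 1) * b)"
  proof (intro mult_left_mono power_decreasing)
    have "(b ^ k - 1) * b = b ^ Suc k - b" by (simp add: diff_mult_distrib2 mult.commute)
    moreover have "b \<le> b ^ Suc k" using pos by simp
    ultimately show "1 + (b ^ k - 1) * b \<le> b ^ Suc k - 1" using b by linarith
  qed (use \<pi> \<kappa> in auto)
  also have "\<dots> = \<kappa> * (\<pi> ^ (b ^ k) * \<kappa> ^ (b ^ k - 1)) ^ b"
    by (simp add: power_mult_distrib power_mult[symmetric] mult.commute)
  also have "\<dots> \<le> \<kappa> * success (k + r) (y + real k * l) (real b ^ k * w) ^ b"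
    using Suc \<pi> \<kappa> unfolding \<pi>_def[symmetric] \<kappa>_def[symmetric]
    by (intro mult_left_mono power_mono) auto
  also have "\<dots> = pmf p b * (measure \<mu> {l..} * success (k + r) (y + real k * l) (real b ^ k * w)) ^ b"
    by (simp add: \<kappa>_def power_mult_distrib)
  also have "\<dots> \<le> success (Suc (k + r)) (y + real k * l + l) (real b * (real b ^ k * w))"
    by (rule success_Suc)
  finally show ?case by (simp add: \<pi>_def \<kappa>_def algebra_simps)
qed

end

section \<open>The rate function and large deviations of the walk\<close>

text \<open>
  The step law with \<open>L\<close> as its essential supremum; the moment generating function is then finite on \<open>[0, \<infinity>)\<close>.
\<close>

locale bounded_step = real_distribution \<mu> for \<mu> :: "real measure" +
  fixes L :: real
  assumes integrable_id: "integrable \<mu> (\<lambda>y. y)"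
    and centred: "(\<integral>y. y \<partial>\<mu>) = 0"
    and L_pos: "0 < L"
    and bounded: "AE y in \<mu>. y \<le> L"
    and reaches: "\<And>y. y < L \<Longrightarrow> 0 < measure \<mu> {y<..}"
begin

definition mgf :: "real \<Rightarrow> real" where
  "mgf t = (\<integral>y. exp (t * y) \<partial>\<mu>)"

definition cgf :: "real \<Rightarrow> real" where
  "cgf t = ln (mgf t)"

text \<open>
  The rate function as a real number. The supremum is finite below \<open>L\<close>.
\<close>

definition legendre :: "real \<Rightarrow> real" where
  "legendre z = (SUP t\<in>{0..}. t * z - cgf t)"

lemma integrable_exp: "0 \<le> t \<Longrightarrow> integrable \<mu> (\<lambda>y. exp (t * y))"
proof (rule integrable_const_bound[where B = "exp (t * L)"])
  assume "0 \<le> t"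
  show "AE y in \<mu>. norm (exp (t * y)) \<le> exp (t * L)"
    using bounded by eventually_elim (use \<open>0 \<le> t\<close> in \<open>simp add: mult_left_mono\<close>)
qed measurable

lemma mgf_ge_1: assumes "0 \<le> t" shows "1 \<le> mgf t"
proof -
  have "1 = (\<integral>y. 1 + t * y \<partial>\<mu>)"
    using integrable_id centred prob_space by simp
  also have "\<dots> \<le> mgf t"
    unfolding mgf_def using integrable_id assms
    by (intro integral_mono integrable_exp) (auto intro: exp_ge_add_one_self)
  finally show ?thesis .
qed

lemma mgf_pos: "0 \<le> t \<Longrightarrow> 0 < mgf t"
  using mgf_ge_1[of t] by simp

lemma cgf_nonneg: "0 \<le> t \<Longrightarrow> 0 \<le> cgf t"
  using mgf_ge_1[of t] by (simp add: cgf_def)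

lemma cgf_0: "cgf 0 = 0"
  using prob_space by (simp add: cgf_def mgf_def)

lemma exp_cgf: "0 \<le> t \<Longrightarrow> exp (cgf t) = mgf t"
  by (simp add: cgf_def mgf_pos)

lemma nn_integral_exp: "0 \<le> t \<Longrightarrow> (\<integral>\<^sup>+y. ennreal (exp (t * y)) \<partial>\<mu>) = ennreal (mgf t)"
  unfolding mgf_def by (intro nn_integral_eq_integral integrable_exp) auto

text \<open>
  The walk can profit from steps beyond \<open>y\<close>; this makes \<open>cgf\<close> grow at least with slope \<open>y\<close> for every \<open>y < L\<close>,
  which is what keeps the Legendre transform finite below \<open>L\<close>.
\<close>

lemma cgf_ge:
  assumes "0 \<le> t" "y < L"
  shows "t * y + ln (measure \<mu> {y<..}) \<le> cgf t"
proof -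
  have "(\<integral>x. exp (t * y) * indicator {y<..} x \<partial>\<mu>) \<le> mgf t"
    unfolding mgf_def
  proof (rule integral_mono)
    fix x
    show "exp (t * y) * indicator {y<..} x \<le> exp (t * x)"
      using assms by (auto simp: mult_left_mono split: split_indicator)
  qed (use assms integrable_exp in \<open>auto simp: emeasure_eq_measure\<close>)
  then have "exp (t * y) * measure \<mu> {y<..} \<le> mgf t" by simp
  then have "ln (exp (t * y) * measure \<mu> {y<..}) \<le> cgf t"
    unfolding cgf_def using reaches[OF assms(2)] mgf_pos[OF assms(1)] by (subst ln_le_cancel_iff) auto
  then show ?thesis using reaches[OF assms(2)] by (simp add: ln_mult)
qed

lemma bdd_above_legendre: assumes "z < L" shows "bdd_above ((\<lambda>t. t * z - cgf t) ` {0..})"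
proof (rule bdd_aboveI2)
  fix t :: real assume "t \<in> {0..}"
  then show "t * z - cgf t \<le> - ln (measure \<mu> {z<..})"
    using cgf_ge[of t z] assms by simp
qed

lemma le_legendre: "z < L \<Longrightarrow> 0 \<le> t \<Longrightarrow> t * z - cgf t \<le> legendre z"
  unfolding legendre_def by (rule cSUP_upper) (auto intro: bdd_above_legendre)

lemma legendre_le: "(\<And>t. 0 \<le> t \<Longrightarrow> t * z - cgf t \<le> c) \<Longrightarrow> legendre z \<le> c"
  unfolding legendre_def by (rule cSUP_least) auto

lemma rate_eq_legendre: assumes "z < L" shows "rate \<mu> z = ereal (legendre z)"
proof -
  have "rate \<mu> z = (SUP t\<in>{0..}. ereal (t * z - cgf t))"
    unfolding rate_def
  proof (rule SUP_cong)
    fix t :: real assume "t \<in> {0..}"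
    then have "elog (enn2ereal (\<integral>\<^sup>+y. ennreal (exp (t * y)) \<partial>\<mu>)) = ereal (cgf t)"
      using mgf_pos[of t] by (simp add: nn_integral_exp elog_def cgf_def)
    then show "ereal (t * z) - elog (enn2ereal (\<integral>\<^sup>+y. ennreal (exp (t * y)) \<partial>\<mu>)) = ereal (t * z - cgf t)"
      by simp
  qed simp
  also have "\<dots> = ereal (legendre z)"
  proof (rule antisym)
    show "(SUP t\<in>{0..}. ereal (t * z - cgf t)) \<le> ereal (legendre z)"
      using assms by (intro SUP_least) (auto intro: le_legendre)
    show "ereal (legendre z) \<le> (SUP t\<in>{0..}. ereal (t * z - cgf t))" (is "_ \<le> ?S")
    proof (cases ?S)
      case (real s)
      have "legendre z \<le> s"
      proof (rule legendre_le)
        fix t :: real assume "0 \<le> t"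
        then have "ereal (t * z - cgf t) \<le> ?S" by (intro SUP_upper) auto
        then show "t * z - cgf t \<le> s" by (simp add: real)
      qed
      then show ?thesis by (simp add: real)
    next
      case MInf
      have "ereal (0 * z - cgf 0) \<le> ?S" by (rule SUP_upper) auto
      then show ?thesis by (simp add: MInf)
    qed simp
  qed
  finally show ?thesis .
qed

lemma legendre_nonneg: "z < L \<Longrightarrow> 0 \<le> legendre z"
  using le_legendre[of z 0] by (simp add: cgf_0)

lemma legendre_nonpos: "z \<le> 0 \<Longrightarrow> legendre z = 0"
proof (rule antisym)
  assume "z \<le> 0"
  show "legendre z \<le> 0"
  proof (rule legendre_le)
    fix t :: real assume "0 \<le> t"
    then have "t * z \<le> 0" using \<open>z \<le> 0\<close> by (rule mult_nonneg_nonpos)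
    then show "t * z - cgf t \<le> 0" using cgf_nonneg[OF \<open>0 \<le> t\<close>] by simp
  qed
  show "0 \<le> legendre z" using \<open>z \<le> 0\<close> L_pos by (intro legendre_nonneg) simp
qed

lemma legendre_mono: "z \<le> z' \<Longrightarrow> z' < L \<Longrightarrow> legendre z \<le> legendre z'"
proof (rule legendre_le)
  fix t :: real assume "z \<le> z'" "z' < L" "0 \<le> t"
  then show "t * z - cgf t \<le> legendre z'"
    using le_legendre[of z' t] mult_left_mono[of z z' t] by simp
qed

text \<open>
  A supremum of affine functions is convex.
\<close>

lemma legendre_convex: "convex_on {..<L} legendre"
proof (rule convex_onI)
  fix u z z' :: real assume u: "0 < u" "u < 1" and z: "z \<in> {..<L}" "z' \<in> {..<L}"
  have "legendre ((1 - u) * z + u * z') \<le> (1 - u) * legendre z + u * legendre z'"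
  proof (rule legendre_le)
    fix t :: real assume "0 \<le> t"
    have "(1 - u) * (t * z - cgf t) + u * (t * z' - cgf t) \<le> (1 - u) * legendre z + u * legendre z'"
      using u z \<open>0 \<le> t\<close> by (intro add_mono mult_left_mono le_legendre) auto
    then show "t * ((1 - u) * z + u * z') - cgf t \<le> (1 - u) * legendre z + u * legendre z'"
      by (simp add: algebra_simps)
  qed
  then show "legendre ((1 - u) *\<^sub>R z + u *\<^sub>R z') \<le> (1 - u) * legendre z + u * legendre z'"
    by simp
qed simp

lemma legendre_continuous: "continuous_on {..<L} legendre"
  by (rule convex_on_continuous) (auto intro: legendre_convex)

text \<open>
  Since the mean is zero, \<open>cgf t = o(t)\<close> at \<open>0\<close>, so that \<open>t * z\<close> wins for small \<open>t\<close>. The left tail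
  may lack a second moment, hence dominated convergence of \<open>(exp (t * y) - 1) / t\<close> along \<open>t = 1 / (n + 1)\<close>
  instead of a Taylor expansion.
\<close>

lemma legendre_pos: assumes "0 < z" "z < L" shows "0 < legendre z"
proof -
  define f where "f n y = real (Suc n) * (exp (y / real (Suc n)) - 1)" for n and y :: real
  have "(\<lambda>n. \<integral>y. f n y \<partial>\<mu>) \<longlonglongrightarrow> (\<integral>y. y \<partial>\<mu>)"
  proof (rule integral_dominated_convergence[where w = "\<lambda>y. \<bar>y\<bar> * exp L"])
    show "integrable \<mu> (\<lambda>y. \<bar>y\<bar> * exp L)" using integrable_id by simp
    show "AE y in \<mu>. (\<lambda>n. f n y) \<longlonglongrightarrow> y"
    proof (rule AE_I2)
      fix y :: real
      show "(\<lambda>n. f n y) \<longlonglongrightarrow> y" unfolding f_def by real_asymp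
    qed
    show "AE y in \<mu>. norm (f n y) \<le> \<bar>y\<bar> * exp L" for n
      using bounded
    proof eventually_elim
      case (elim y)
      define u where "u = y / real (Suc n)"
      have y: "y = real (Suc n) * u" by (simp add: u_def)
      have "\<bar>exp u - 1\<bar> \<le> \<bar>u\<bar> * exp L"
      proof (cases "0 \<le> u")
        case True
        have "u \<le> y" using True mult_right_mono[of 1 "real (Suc n)" u] by (simp add: y)
        then have "exp u \<le> exp L" using elim by simp
        have "exp u * (1 - u) \<le> exp u * exp (- u)"
          using exp_ge_add_one_self[of "- u"] by (intro mult_left_mono) auto
        then have "exp u - 1 \<le> u * exp u" by (simp add: exp_minus field_simps)
        also have "\<dots> \<le> u * exp L" using True \<open>exp u \<le> exp L\<close> by (intro mult_left_mono)
        finally show ?thesis using True by simp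
      next
        case False
        have "exp u < 1" using False by simp
        then have "\<bar>exp u - 1\<bar> \<le> \<bar>u\<bar> * 1" using False exp_ge_add_one_self[of u] by linarith
        also have "\<dots> \<le> \<bar>u\<bar> * exp L" using L_pos by (intro mult_left_mono) auto
        finally show ?thesis .
      qed
      then have "real (Suc n) * \<bar>exp u - 1\<bar> \<le> real (Suc n) * (\<bar>u\<bar> * exp L)"
        by (intro mult_left_mono) auto
      then show ?case unfolding f_def u_def[symmetric] by (simp add: y abs_mult del: of_nat_Suc)
    qed
  qed (simp_all add: f_def)
  then have "\<forall>\<^sub>F n in sequentially. (\<integral>y. f n y \<partial>\<mu>) < z"
    using assms centred by (intro order_tendstoD) auto
  then obtain n where n: "(\<integral>y. f n y \<partial>\<mu>) < z"
    by (auto simp: eventually_sequentially)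
  define t where "t = 1 / real (Suc n)"
  have t: "0 < t" by (simp add: t_def)
  have "(\<integral>y. f n y \<partial>\<mu>) = (mgf t - 1) / t"
    unfolding f_def mgf_def using integrable_exp[of t] t prob_space by (simp add: t_def del: of_nat_Suc)
  then have "mgf t - 1 = t * (\<integral>y. f n y \<partial>\<mu>)" using t by simp
  then have "mgf t - 1 < t * z" using mult_strict_left_mono[OF n t] by simp
  moreover have "cgf t \<le> mgf t - 1"
    unfolding cgf_def using mgf_pos[of t] t by (intro ln_le_minus_one) auto
  ultimately have "0 < t * z - cgf t" by simp
  also have "\<dots> \<le> legendre z" using assms t by (intro le_legendre) auto
  finally show ?thesis .
qed

lemma legendre_scale: assumes "0 \<le> u" "u \<le> 1" "z < L" shows "legendre (u * z) \<le> u * legendre z"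
proof (cases "u = 0 \<or> u = 1")
  case False
  with assms have "legendre ((1 - u) *\<^sub>R 0 + u *\<^sub>R z) \<le> (1 - u) * legendre 0 + u * legendre z"
    using L_pos by (intro convex_onD[OF legendre_convex]) auto
  then show ?thesis by (simp add: legendre_nonpos)
qed (auto simp: legendre_nonpos)

lemma legendre_strict_mono: assumes "0 \<le> z" "z < z'" "z' < L" shows "legendre z < legendre z'"
proof -
  have "legendre z = legendre (z / z' * z')" using assms by simp
  also have "\<dots> \<le> z / z' * legendre z'" using assms by (intro legendre_scale) auto
  also have "\<dots> < 1 * legendre z'"
    using assms legendre_pos[of z'] by (intro mult_strict_right_mono) auto
  finally show ?thesis by simp
qed

lemma integral_walk_law_exp:
  assumes "0 \<le> t"
  shows "(\<integral>\<^sup>+s. ennreal (exp (t * s)) \<partial>walk_law \<mu> n) = ennreal (mgf t ^ n)"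
  using mgf_pos[OF assms] by (simp add: walk_law_mgf nn_integral_exp assms ennreal_power)

lemma tail_markov: assumes "0 \<le> t" shows "tail \<mu> n y \<le> exp (- t * y) * mgf t ^ n"
proof -
  have "ennreal (tail \<mu> n y) = (\<integral>\<^sup>+s. indicator {y..} s \<partial>walk_law \<mu> n)"
    by (simp add: ennreal_tail)
  also have "\<dots> \<le> (\<integral>\<^sup>+s. ennreal (exp (- t * y)) * ennreal (exp (t * s)) \<partial>walk_law \<mu> n)"
  proof (rule nn_integral_mono)
    fix s
    have "ennreal 1 \<le> ennreal (exp (- t * y + t * s))" if "y \<le> s"
      using assms that by (intro ennreal_leI) (simp add: mult_left_mono)
    then show "indicator {y..} s \<le> ennreal (exp (- t * y)) * ennreal (exp (t * s))"
      by (auto simp: ennreal_mult[symmetric] exp_add[symmetric] split: split_indicator)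
  qed
  also have "\<dots> = ennreal (exp (- t * y) * mgf t ^ n)"
    using mgf_pos[OF assms]
    by (subst nn_integral_cmult) (auto simp: integral_walk_law_exp[OF assms] ennreal_mult)
  finally show ?thesis using mgf_pos[OF assms] by (simp add: ennreal_le_iff)
qed

text \<open>
  Optimizing the exponential Markov inequality over \<open>t\<close>.
\<close>

lemma chernoff:
  assumes "0 < n" "z < L"
  shows "tail \<mu> n (real n * z) \<le> exp (- real n * legendre z)"
proof (cases "tail \<mu> n (real n * z) = 0")
  case False
  then have pos: "0 < tail \<mu> n (real n * z)" using tail_nonneg[of n "real n * z"] by simp
  have "legendre z \<le> - ln (tail \<mu> n (real n * z)) / real n"
  proof (rule legendre_le)
    fix t :: real assume t: "0 \<le> t"
    have "ln (tail \<mu> n (real n * z)) \<le> ln (exp (- t * (real n * z)) * mgf t ^ n)"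
      using pos tail_markov[OF t, of n "real n * z"] mgf_pos[OF t] by (subst ln_le_cancel_iff) auto
    also have "\<dots> = - real n * (t * z - cgf t)"
      using mgf_pos[OF t] by (simp add: ln_mult ln_realpow cgf_def algebra_simps)
    finally show "t * z - cgf t \<le> - ln (tail \<mu> n (real n * z)) / real n"
      using assms by (simp add: field_simps)
  qed
  then have "ln (tail \<mu> n (real n * z)) \<le> - real n * legendre z"
    using assms by (simp add: field_simps)
  then have "exp (ln (tail \<mu> n (real n * z))) \<le> exp (- real n * legendre z)" by simp
  then show ?thesis using pos by simp
qed simp

text \<open>
  Differentiability away from \<open>0\<close>, with an explicit remainder: for \<open>\<bar>s\<bar> \<le> t / 2\<close> the second-order term
  \<open>y\<^sup>2 exp (t * y + \<bar>s * y\<bar>)\<close> is bounded, on the left by \<open>exp (t * y / 2)\<close> and on the right by \<open>y \<le> L\<close>.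
\<close>

lemma mgf_quadratic:
  assumes t: "0 < t"
  obtains D C where "\<And>s. \<bar>s\<bar> \<le> t / 2 \<Longrightarrow> \<bar>mgf (t + s) - mgf t - s * D\<bar> \<le> C * s\<^sup>2" "0 \<le> C"
proof
  define C where "C = 8 / t\<^sup>2 + L\<^sup>2 * exp (2 * t * L)"
  show C: "0 \<le> C" by (simp add: C_def)
  have int: "integrable \<mu> (\<lambda>y. y * exp (t * y))"
  proof (rule Bochner_Integration.integrable_bound)
    show "integrable \<mu> (\<lambda>y. \<bar>y\<bar> * exp (t * L))" using integrable_id by simp
    show "AE y in \<mu>. norm (y * exp (t * y)) \<le> norm (\<bar>y\<bar> * exp (t * L))"
      using bounded by eventually_elim (use t in \<open>simp add: abs_mult mult_left_mono\<close>)
  qed measurable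
  fix s assume s: "\<bar>s\<bar> \<le> t / 2"
  have ts: "0 \<le> t + s" using s by linarith
  let ?R = "\<lambda>y. exp ((t + s) * y) - exp (t * y) - s * (y * exp (t * y))"
  have R: "integrable \<mu> ?R"
    using int integrable_exp[of t] integrable_exp[OF ts] t by simp
  have "mgf (t + s) - mgf t - s * (\<integral>y. y * exp (t * y) \<partial>\<mu>) = (\<integral>y. ?R y \<partial>\<mu>)"
    unfolding mgf_def using int integrable_exp[of t] integrable_exp[OF ts] t by simp
  moreover have "\<bar>\<integral>y. ?R y \<partial>\<mu>\<bar> \<le> (\<integral>y. \<bar>?R y\<bar> \<partial>\<mu>)"
    by (rule integral_abs_bound)
  moreover have "(\<integral>y. \<bar>?R y\<bar> \<partial>\<mu>) \<le> (\<integral>y. C * s\<^sup>2 \<partial>\<mu>)"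
  proof (rule integral_mono_AE)
    show "AE y in \<mu>. \<bar>?R y\<bar> \<le> C * s\<^sup>2"
      using bounded
    proof eventually_elim
      case (elim y)
      obtain v where v: "\<bar>v\<bar> \<le> \<bar>s * y\<bar>" and e: "exp (s * y) = 1 + s * y + exp v / 2 * (s * y)\<^sup>2"
        using Maclaurin_exp_le[of "s * y" 2] by (auto simp: numeral_2_eq_2)
      have "?R y = exp (t * y) * (exp (s * y) - 1 - s * y)"
        by (simp add: ring_distribs exp_add algebra_simps)
      also have "\<dots> = exp (t * y + v) / 2 * y\<^sup>2 * s\<^sup>2"
        unfolding e by (simp add: exp_add power_mult_distrib)
      finally have eq: "?R y = exp (t * y + v) / 2 * y\<^sup>2 * s\<^sup>2" .
      have vy: "v \<le> t / 2 * \<bar>y\<bar>"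
        using v mult_right_mono[OF s abs_ge_zero[of y]] by (simp add: abs_mult)
      have "exp (t * y + v) / 2 * y\<^sup>2 \<le> C"
      proof (cases "0 \<le> y")
        case True
        have "v \<le> t * y / 2" using vy True by simp
        moreover have "0 \<le> t * y" using t True by simp
        ultimately have "t * y + v \<le> 2 * t * y" by linarith
        also have "\<dots> \<le> 2 * t * L" using elim t by simp
        finally have "exp (t * y + v) \<le> exp (2 * t * L)" by simp
        then have "exp (t * y + v) / 2 \<le> exp (2 * t * L)"
          using exp_gt_zero[of "2 * t * L"] by linarith
        then have "exp (t * y + v) / 2 * y\<^sup>2 \<le> exp (2 * t * L) * L\<^sup>2"
          using True elim t L_pos by (intro mult_mono power_mono) auto
        then show ?thesis by (simp add: C_def mult.commute add_increasing)
      next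
        case False
        define q where "q = t * (- y) / 2"
        have q: "0 \<le> q" using False t by (simp add: q_def mult_nonneg_nonpos)
        have "1 + q + q\<^sup>2 / 2 \<le> exp q" using q by (rule exp_lower_Taylor_quadratic)
        then have "q\<^sup>2 \<le> 2 * exp q" using q by linarith
        have "exp (t * y + v) \<le> exp (- q)"
          using vy False by (simp add: q_def field_simps)
        then have "exp (t * y + v) / 2 \<le> exp (- q)" using exp_gt_zero[of "- q"] by linarith
        then have "exp (t * y + v) / 2 * y\<^sup>2 \<le> exp (- q) * y\<^sup>2" by (rule mult_right_mono) simp
        also have "\<dots> = exp (- q) * (4 / t\<^sup>2 * q\<^sup>2)"
          using t by (simp add: q_def power_mult_distrib power_divide)
        also have "\<dots> \<le> exp (- q) * (4 / t\<^sup>2 * (2 * exp q))"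
          using \<open>q\<^sup>2 \<le> 2 * exp q\<close> by (intro mult_left_mono) auto
        also have "\<dots> = 8 / t\<^sup>2" by (simp add: exp_minus)
        also have "\<dots> \<le> C" by (simp add: C_def)
        finally show ?thesis .
      qed
      then have "exp (t * y + v) / 2 * y\<^sup>2 * s\<^sup>2 \<le> C * s\<^sup>2" by (rule mult_right_mono) simp
      moreover have "0 \<le> exp (t * y + v) / 2 * y\<^sup>2 * s\<^sup>2" by simp
      ultimately show ?case unfolding eq by linarith
    qed
  qed (use R in auto)
  moreover have "(\<integral>y. C * s\<^sup>2 \<partial>\<mu>) = C * s\<^sup>2" using prob_space by simp
  ultimately show "\<bar>mgf (t + s) - mgf t - s * (\<integral>y. y * exp (t * y) \<partial>\<mu>)\<bar> \<le> C * s\<^sup>2" by linarith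
qed

lemma mgf_differentiable:
  assumes t: "0 < t"
  obtains D where "(mgf has_real_derivative D) (at t)"
proof -
  obtain D C where C: "\<And>s. \<bar>s\<bar> \<le> t / 2 \<Longrightarrow> \<bar>mgf (t + s) - mgf t - s * D\<bar> \<le> C * s\<^sup>2" "0 \<le> C"
    using mgf_quadratic[OF t] by blast
  have "((\<lambda>s. (mgf (t + s) - mgf t) / s - D) \<longlongrightarrow> 0) (at 0)"
  proof (rule Lim_null_comparison)
    have "\<forall>\<^sub>F s in at 0. \<bar>s\<bar> \<le> t / 2 \<and> s \<noteq> 0"
      using t by (auto simp: eventually_at dist_real_def intro!: exI[of _ "t / 2"])
    then show "\<forall>\<^sub>F s in at 0. norm ((mgf (t + s) - mgf t) / s - D) \<le> C * \<bar>s\<bar>"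
    proof eventually_elim
      case (elim s)
      then have "(mgf (t + s) - mgf t) / s - D = (mgf (t + s) - mgf t - s * D) / s"
        by (simp add: field_simps)
      then have "norm ((mgf (t + s) - mgf t) / s - D) = \<bar>mgf (t + s) - mgf t - s * D\<bar> / \<bar>s\<bar>"
        by simp
      also have "\<dots> \<le> C * s\<^sup>2 / \<bar>s\<bar>"
        using C(1)[of s] elim by (intro divide_right_mono) auto
      also have "\<dots> = C * \<bar>s\<bar>" using elim by (simp add: power2_eq_square abs_if)
      finally show ?case .
    qed
    show "((\<lambda>s. C * \<bar>s\<bar>) \<longlongrightarrow> 0) (at 0)"
      by (auto intro!: tendsto_eq_intros)
  qed
  then have "((\<lambda>s. (mgf (t + s) - mgf t) / s) \<longlongrightarrow> D) (at 0)"
    by (simp add: LIM_zero_iff)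
  then show ?thesis by (intro that[of D]) (simp add: DERIV_def)
qed

lemma cgf_differentiable:
  assumes t: "0 < t"
  obtains D where "(cgf has_real_derivative D) (at t)"
proof -
  obtain D where "(mgf has_real_derivative D) (at t)" using mgf_differentiable[OF t] .
  then have "(cgf has_real_derivative (1 / mgf t * D)) (at t)"
    unfolding cgf_def [abs_def] using t by (intro DERIV_ln_divide[THEN DERIV_chain2] mgf_pos) auto
  then show ?thesis by (rule that)
qed

text \<open>
  Near \<open>t = 0\<close> the function \<open>t * z - cgf t\<close> is below half its supremum, and far out it is negative because
  \<open>cgf\<close> grows faster than \<open>t * z\<close>; on the compact interval in between it is continuous.
\<close>

lemma legendre_attained:
  assumes z: "0 < z" "z < L"
  obtains t where "0 < t" "legendre z = t * z - cgf t"
proof -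
  define \<epsilon> where "\<epsilon> = legendre z / (2 * z)"
  have \<epsilon>: "0 < \<epsilon>" using legendre_pos[OF z] z by (simp add: \<epsilon>_def)
  define y where "y = (z + L) / 2"
  have y: "z < y" "y < L" using z by (auto simp: y_def)
  define T where "T = max \<epsilon> (- ln (measure \<mu> {y<..}) / (y - z))"
  have "continuous_on {\<epsilon>..T} (\<lambda>t. t * z - cgf t)"
  proof (intro continuous_intros)
    have "isCont cgf t" if "t \<in> {\<epsilon>..T}" for t
    proof -
      have "0 < t" using that \<epsilon> by simp
      then obtain D where "(cgf has_real_derivative D) (at t)" using cgf_differentiable by blast
      then show ?thesis by (rule DERIV_isCont)
    qed
    then show "continuous_on {\<epsilon>..T} cgf"
      by (simp add: continuous_at_imp_continuous_on)
  qed
  moreover have "{\<epsilon>..T} \<noteq> {}" by (simp add: T_def)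
  ultimately obtain t0 where t0: "t0 \<in> {\<epsilon>..T}" "\<And>t. t \<in> {\<epsilon>..T} \<Longrightarrow> t * z - cgf t \<le> t0 * z - cgf t0"
    using continuous_attains_sup[of "{\<epsilon>..T}" "\<lambda>t. t * z - cgf t"] by auto
  have "legendre z \<le> max (t0 * z - cgf t0) (legendre z / 2)"
  proof (rule legendre_le)
    fix t :: real assume t: "0 \<le> t"
    consider "t < \<epsilon>" | "t \<in> {\<epsilon>..T}" | "T < t" by force
    then show "t * z - cgf t \<le> max (t0 * z - cgf t0) (legendre z / 2)"
    proof cases
      case 1
      have "t * z \<le> \<epsilon> * z" using 1 z by (intro mult_right_mono) auto
      then have "t * z - cgf t \<le> legendre z / 2" using cgf_nonneg[OF t] z by (simp add: \<epsilon>_def)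
      then show ?thesis by simp
    next
      case 2
      then show ?thesis using t0(2)[OF 2] by simp
    next
      case 3
      have "- ln (measure \<mu> {y<..}) / (y - z) \<le> t" using 3 by (simp add: T_def)
      then have "- ln (measure \<mu> {y<..}) \<le> t * (y - z)" using y by (simp add: field_simps)
      then have "t * z - cgf t \<le> 0" using cgf_ge[OF t y(2)] by (simp add: algebra_simps)
      then show ?thesis using legendre_nonneg[OF z(2)] by (simp add: max.coboundedI2)
    qed
  qed
  then have "legendre z \<le> t0 * z - cgf t0" using legendre_pos[OF z] by (simp add: le_max_iff_disj)
  moreover have "0 < t0" using t0 \<epsilon> by simp
  ultimately show ?thesis
    using le_legendre[of z t0] z by (intro that[of t0]) auto
qed

text \<open>
  Cramer's lower bound. Instead of a change of measure, \<open>mgf t ^ n\<close> at the optimal \<open>t\<close> is split according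
  to the position of the walk. The parts above \<open>n * (z + h)\<close> and below \<open>n * (z - h)\<close> are compared with
  \<open>mgf (t + s) ^ n\<close> and \<open>mgf (t - s) ^ n\<close>; they are exponentially smaller than \<open>mgf t ^ n\<close>, because \<open>cgf\<close> has
  derivative \<open>z\<close> at \<open>t\<close>. The remaining part is at most \<open>exp (t * n * (z + h))\<close> times the tail.
\<close>

lemma cramer_lower:
  assumes z: "0 < z" "z < L" and \<delta>: "0 < \<delta>"
  shows "\<forall>\<^sub>F n in sequentially. exp (- real n * (legendre z + \<delta>)) \<le> tail \<mu> n (real n * (z - \<delta>))"
proof -
  obtain t where t: "0 < t" "legendre z = t * z - cgf t" using legendre_attained[OF z] .
  define h where "h = min \<delta> (\<delta> / (2 * t))"
  have h: "0 < h" "h \<le> \<delta>" "t * h \<le> \<delta> / 2" using \<delta> t by (auto simp: h_def min_def field_simps)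
  obtain D where D: "(cgf has_real_derivative D) (at t)" using cgf_differentiable[OF t(1)] .
  have "((\<lambda>t. t * z - cgf t) has_real_derivative z - D) (at t)"
    by (rule derivative_eq_intros D refl)+ simp
  then have "z - D = 0"
  proof (rule DERIV_local_max)
    show "0 < t" by fact
    show "\<forall>y. \<bar>t - y\<bar> < t \<longrightarrow> y * z - cgf y \<le> t * z - cgf t"
      using le_legendre[OF z(2)] t by (auto simp: abs_less_iff)
  qed
  then have "((\<lambda>s. (cgf (t + s) - cgf t) / s) \<longlongrightarrow> z) (at 0)"
    using D by (simp add: DERIV_def)
  then have "\<forall>\<^sub>F s in at 0. dist ((cgf (t + s) - cgf t) / s) z < h" using h by (intro tendstoD) auto
  then obtain d where d: "0 < d" "\<And>s. s \<noteq> 0 \<Longrightarrow> \<bar>s\<bar> < d \<Longrightarrow> \<bar>(cgf (t + s) - cgf t) / s - z\<bar> < h"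
    unfolding eventually_at by (auto simp: dist_real_def)
  define s where "s = min d t / 2"
  have s: "0 < s" "s < d" "s < t" using d t by (auto simp: s_def)
  have "(cgf (t + s) - cgf t) / s < z + h" using d(2)[of s] s by (auto simp: abs_less_iff)
  then have a: "cgf (t + s) - cgf t - s * (z + h) < 0" using s by (simp add: field_simps)
  have "z - h < (cgf (t + (- s)) - cgf t) / (- s)" using d(2)[of "- s"] s by (auto simp: abs_less_iff)
  then have b: "cgf (t - s) - cgf t + s * (z - h) < 0" using s by (simp add: field_simps)
  define \<alpha> where "\<alpha> = exp (cgf (t + s) - cgf t - s * (z + h))"
  define \<beta> where "\<beta> = exp (cgf (t - s) - cgf t + s * (z - h))"
  have \<alpha>: "0 < \<alpha>" "\<alpha> < 1" and \<beta>: "0 < \<beta>" "\<beta> < 1" using a b by (auto simp: \<alpha>_def \<beta>_def)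
  have main: "exp (- real n * (legendre z + t * h)) * (1 - \<alpha> ^ n - \<beta> ^ n) \<le> tail \<mu> n (real n * (z - h))" for n
  proof -
    let ?lo = "real n * (z - h)" and ?hi = "real n * (z + h)"
    have "ennreal (mgf t ^ n) = (\<integral>\<^sup>+x. ennreal (exp (t * x)) \<partial>walk_law \<mu> n)"
      using t by (simp add: integral_walk_law_exp)
    also have "\<dots> \<le> (\<integral>\<^sup>+x. ennreal (exp (t * ?hi)) * indicator {?lo..} x +
        (ennreal (exp (- s * ?hi)) * ennreal (exp ((t + s) * x)) +
         ennreal (exp (s * ?lo)) * ennreal (exp ((t - s) * x))) \<partial>walk_law \<mu> n)"
    proof (rule nn_integral_mono)
      fix x
      have "exp (t * x) \<le> exp (t * ?hi) * indicator {?lo..} x +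
          (exp (- s * ?hi) * exp ((t + s) * x) + exp (s * ?lo) * exp ((t - s) * x))"
      proof -
        consider "x < ?lo" | "?lo \<le> x" "x \<le> ?hi" | "?hi < x" by linarith
        then show ?thesis
        proof cases
          case 1
          then have "t * x \<le> s * ?lo + (t - s) * x"
            using mult_left_mono[of x ?lo s] s by (simp add: algebra_simps)
          then have "exp (t * x) \<le> exp (s * ?lo) * exp ((t - s) * x)" by (simp add: exp_add[symmetric])
          then show ?thesis by (simp add: add_increasing add_increasing2)
        next
          case 2
          then have "exp (t * x) \<le> exp (t * ?hi)" using t by (simp add: mult_left_mono)
          then show ?thesis using 2 by (simp add: add_increasing2)
        next
          case 3
          then have "t * x \<le> - s * ?hi + (t + s) * x"
            using mult_left_mono[of ?hi x s] s by (simp add: algebra_simps)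
          then have "exp (t * x) \<le> exp (- s * ?hi) * exp ((t + s) * x)" by (simp add: exp_add[symmetric])
          then show ?thesis by (simp add: add_increasing add_increasing2)
        qed
      qed
      then have "ennreal (exp (t * x)) \<le> ennreal (exp (t * ?hi) * indicator {?lo..} x +
          (exp (- s * ?hi) * exp ((t + s) * x) + exp (s * ?lo) * exp ((t - s) * x)))"
        by (rule ennreal_leI)
      also have "\<dots> = ennreal (exp (t * ?hi)) * indicator {?lo..} x +
        (ennreal (exp (- s * ?hi)) * ennreal (exp ((t + s) * x)) +
         ennreal (exp (s * ?lo)) * ennreal (exp ((t - s) * x)))"
        by (subst ennreal_plus) (auto simp: ennreal_mult split: split_indicator)
      finally show "ennreal (exp (t * x)) \<le> ennreal (exp (t * ?hi)) * indicator {?lo..} x +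
        (ennreal (exp (- s * ?hi)) * ennreal (exp ((t + s) * x)) +
         ennreal (exp (s * ?lo)) * ennreal (exp ((t - s) * x)))" .
    qed
    also have "\<dots> = ennreal (exp (t * ?hi)) * ennreal (tail \<mu> n ?lo) +
        (ennreal (exp (- s * ?hi)) * ennreal (mgf (t + s) ^ n) +
         ennreal (exp (s * ?lo)) * ennreal (mgf (t - s) ^ n))"
      using s t by (simp add: nn_integral_add nn_integral_cmult integral_walk_law_exp ennreal_tail)
    also have "\<dots> = ennreal (exp (t * ?hi) * tail \<mu> n ?lo +
        (exp (- s * ?hi) * mgf (t + s) ^ n + exp (s * ?lo) * mgf (t - s) ^ n))"
    proof -
      have "0 \<le> mgf (t + s) ^ n" "0 \<le> mgf (t - s) ^ n"
        using mgf_pos[of "t + s"] mgf_pos[of "t - s"] s t by auto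
      then show ?thesis using tail_nonneg by (simp add: ennreal_mult ennreal_plus)
    qed
    finally have "mgf t ^ n \<le> exp (t * ?hi) * tail \<mu> n ?lo +
        (exp (- s * ?hi) * mgf (t + s) ^ n + exp (s * ?lo) * mgf (t - s) ^ n)"
      using mgf_pos[of "t + s"] mgf_pos[of "t - s"] s t tail_nonneg[of n ?lo]
      by (subst (asm) ennreal_le_iff) (auto intro!: add_nonneg_nonneg mult_nonneg_nonneg)
    moreover have "exp (- s * ?hi) * mgf (t + s) ^ n = mgf t ^ n * \<alpha> ^ n"
      using s t exp_cgf[of t] exp_cgf[of "t + s"]
      by (simp add: \<alpha>_def exp_of_nat_mult[symmetric] exp_add[symmetric] flip: exp_cgf) (simp add: algebra_simps)
    moreover have "exp (s * ?lo) * mgf (t - s) ^ n = mgf t ^ n * \<beta> ^ n"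
      using s t exp_cgf[of t] exp_cgf[of "t - s"]
      by (simp add: \<beta>_def exp_of_nat_mult[symmetric] exp_add[symmetric] flip: exp_cgf) (simp add: algebra_simps)
    ultimately have "mgf t ^ n * (1 - \<alpha> ^ n - \<beta> ^ n) \<le> exp (t * ?hi) * tail \<mu> n ?lo"
      by (simp add: algebra_simps)
    then have "exp (- t * ?hi) * (mgf t ^ n * (1 - \<alpha> ^ n - \<beta> ^ n)) \<le> exp (- t * ?hi) * (exp (t * ?hi) * tail \<mu> n ?lo)"
      by (rule mult_left_mono) simp
    also have "\<dots> = tail \<mu> n ?lo" by (simp add: exp_minus)
    also have "exp (- t * ?hi) * (mgf t ^ n * (1 - \<alpha> ^ n - \<beta> ^ n)) =
        exp (- real n * (legendre z + t * h)) * (1 - \<alpha> ^ n - \<beta> ^ n)"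
    proof -
      have "exp (- t * ?hi) * mgf t ^ n = exp (- real n * (legendre z + t * h))"
        using t exp_cgf[of t]
        by (simp add: exp_of_nat_mult[symmetric] exp_add[symmetric] flip: exp_cgf) (simp add: algebra_simps)
      then show ?thesis by (simp only: mult.assoc[symmetric])
    qed
    finally show ?thesis .
  qed
  have "(\<lambda>n. \<alpha> ^ n + \<beta> ^ n) \<longlonglongrightarrow> 0 + 0"
    using \<alpha> \<beta> by (intro tendsto_add LIMSEQ_power_zero) auto
  then have "\<forall>\<^sub>F n in sequentially. \<alpha> ^ n + \<beta> ^ n < 1 / 2" by (intro order_tendstoD) auto
  moreover have "\<forall>\<^sub>F n in sequentially. ln 2 < real n * (\<delta> / 2)"
    using \<delta> by real_asymp
  ultimately show ?thesis
  proof eventually_elim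
    case (elim n)
    have "exp (- real n * (legendre z + \<delta>)) \<le> exp (- real n * (legendre z + t * h) - ln 2)"
      using elim(2) mult_left_mono[OF h(3), of "real n"] by (simp add: algebra_simps)
    also have "\<dots> = exp (- real n * (legendre z + t * h)) * (1 / 2)" by (simp add: exp_diff)
    also have "\<dots> \<le> exp (- real n * (legendre z + t * h)) * (1 - \<alpha> ^ n - \<beta> ^ n)"
      using elim(1) by (intro mult_left_mono) auto
    also have "\<dots> \<le> tail \<mu> n (real n * (z - h))" by (rule main)
    also have "\<dots> \<le> tail \<mu> n (real n * (z - \<delta>))"
      using h by (intro tail_antimono mult_left_mono) auto
    finally show ?case .
  qed
qed

end

section \<open>Exponents of growth\<close>

context bounded_step
begin

text \<open>
  A particle that has moved at full speed \<open>L\<close> up to time \<open>s\<close> (in units of the number of generations) needs the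
  speed \<open>(x - s * L) / (1 - s)\<close> from then on; \<open>remaining x s\<close> is the total cost of that.
\<close>

definition remaining :: "real \<Rightarrow> real \<Rightarrow> real" where
  "remaining x s = (1 - s) * legendre ((x - s * L) / (1 - s))"

lemma speed_less_L: assumes "x < L" "s < 1" shows "(x - s * L) / (1 - s) < L"
proof -
  have "x - s * L < L * (1 - s)" using assms by (simp add: algebra_simps)
  then show ?thesis using assms by (simp add: pos_divide_less_eq)
qed

lemma remaining_nonneg: "x < L \<Longrightarrow> s < 1 \<Longrightarrow> 0 \<le> remaining x s"
  unfolding remaining_def by (intro mult_nonneg_nonneg legendre_nonneg speed_less_L) auto

lemma remaining_0: "remaining x 0 = legendre x"
  by (simp add: remaining_def)

lemma remaining_eq_0: "0 < x \<Longrightarrow> x / L \<le> s \<Longrightarrow> s < 1 \<Longrightarrow> remaining x s = 0"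
proof -
  assume "0 < x" "x / L \<le> s" "s < 1"
  then have "(x - s * L) / (1 - s) \<le> 0"
    using L_pos by (intro divide_nonpos_pos) (auto simp: field_simps)
  then show ?thesis by (simp add: remaining_def legendre_nonpos)
qed

text \<open>
  The perspective of a convex function is convex.
\<close>

lemma remaining_convex: assumes x: "x < L" shows "convex_on {..<1} (remaining x)"
proof (rule convex_onI)
  fix u s s' :: real assume u: "0 < u" "u < 1" and s: "s \<in> {..<1}" "s' \<in> {..<1}"
  define z where "z = (x - s * L) / (1 - s)"
  define z' where "z' = (x - s' * L) / (1 - s')"
  define w where "w = (1 - u) * (1 - s) + u * (1 - s')"
  define v where "v = u * (1 - s') / w"
  have w1: "0 < (1 - u) * (1 - s)" "0 < u * (1 - s')" using u s by auto
  then have w: "0 < w" by (simp add: w_def)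
  have v: "0 \<le> v" "v \<le> 1" using w w1 by (auto simp: v_def) (simp add: w_def)
  have v': "1 - v = (1 - u) * (1 - s) / w" using w by (simp add: v_def field_simps) (simp add: w_def algebra_simps)
  have ws: "1 - ((1 - u) * s + u * s') = w" by (simp add: w_def algebra_simps)
  have zs: "(1 - s) * z = x - s * L" "(1 - s') * z' = x - s' * L"
    using s by (auto simp: z_def z'_def)
  have "x - ((1 - u) * s + u * s') * L = (1 - u) * (x - s * L) + u * (x - s' * L)"
    by (simp add: algebra_simps)
  also have "\<dots> = (1 - u) * (1 - s) * z + u * (1 - s') * z'"
    unfolding zs[symmetric] by (simp add: mult.assoc)
  finally have "(x - ((1 - u) * s + u * s') * L) / w = (1 - v) * z + v * z'"
    unfolding v' unfolding v_def by (simp add: add_divide_distrib)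
  then have "remaining x ((1 - u) * s + u * s') = w * legendre ((1 - v) *\<^sub>R z + v *\<^sub>R z')"
    unfolding remaining_def ws by simp
  also have "\<dots> \<le> w * ((1 - v) * legendre z + v * legendre z')"
    using w v s x speed_less_L
    by (intro mult_left_mono convex_onD[OF legendre_convex]) (auto simp: z_def z'_def)
  also have "\<dots> = (1 - u) * ((1 - s) * legendre z) + u * ((1 - s') * legendre z')"
    unfolding distrib_left v' unfolding v_def using w by simp
  finally show "remaining x ((1 - u) *\<^sub>R s + u *\<^sub>R s') \<le> (1 - u) * remaining x s + u * remaining x s'"
    by (simp add: remaining_def z_def z'_def)
qed simp

lemma remaining_continuous: "x < L \<Longrightarrow> continuous_on {..<1} (remaining x)"
  by (rule convex_on_continuous) (auto intro: remaining_convex)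

lemma rate_mono: "z \<le> z' \<Longrightarrow> rate \<mu> z \<le> rate \<mu> z'"
  unfolding rate_def
proof (rule SUP_mono)
  fix t :: real assume "z \<le> z'" "t \<in> {0..}"
  then show "\<exists>t'\<in>{0..}. ereal (t * z) - elog (enn2ereal (\<integral>\<^sup>+y. ennreal (exp (t * y)) \<partial>\<mu>)) \<le>
      ereal (t' * z') - elog (enn2ereal (\<integral>\<^sup>+y. ennreal (exp (t' * y)) \<partial>\<mu>))"
    by (intro bexI[of _ t] ereal_minus_mono) (auto simp: mult_left_mono)
qed

text \<open>
  If a unit of time at speed close to \<open>L\<close> costs at most \<open>l\<close>, then moving at full speed for a time \<open>s\<close>
  first does not increase the exponent \<open>l - legendre x\<close>: the point \<open>x\<close> is a convex combination of \<open>L\<close> and the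
  remaining speed, and \<open>legendre\<close> extends to \<open>L\<close> by lower semicontinuity, one \<open>t\<close> at a time.
\<close>

lemma growth_less_of_max_speed_eq:
  assumes speed: "\<And>y. y < L \<Longrightarrow> legendre y \<le> l" and x: "x < L" and s: "0 \<le> s" "s < 1"
  shows "(1 - s) * l - remaining x s \<le> l - legendre x"
proof -
  define z where "z = (x - s * L) / (1 - s)"
  have z: "z < L" unfolding z_def using x s by (intro speed_less_L) auto
  have atL: "t * L - cgf t \<le> l" if t: "0 \<le> t" for t
  proof (rule tendsto_upperbound)
    show "((\<lambda>y. t * y - cgf t) \<longlongrightarrow> t * L - cgf t) (at_left L)"
      by (intro tendsto_intros)
    have "\<forall>\<^sub>F y in at_left L. y < L" by (simp add: eventually_at_filter)
    then show "\<forall>\<^sub>F y in at_left L. t * y - cgf t \<le> l"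
    proof eventually_elim
      case (elim y)
      then show ?case using le_legendre[OF elim t] speed[OF elim] by simp
    qed
  qed simp
  have "legendre x \<le> s * l + (1 - s) * legendre z"
  proof (rule legendre_le)
    fix t :: real assume t: "0 \<le> t"
    have "x = s * L + (1 - s) * z" using s by (simp add: z_def)
    then have "t * x = t * (s * L + (1 - s) * z)" by simp
    then have "t * x - cgf t = s * (t * L - cgf t) + (1 - s) * (t * z - cgf t)"
      by (simp only: algebra_simps)
    also have "\<dots> \<le> s * l + (1 - s) * legendre z"
      using s atL[OF t] le_legendre[OF z t] by (intro add_mono mult_left_mono) auto
    finally show "t * x - cgf t \<le> s * l + (1 - s) * legendre z" .
  qed
  then show ?thesis unfolding remaining_def z_def[symmetric] by (simp add: algebra_simps)
qed

text \<open>
  Existence and uniqueness behind \<open>y_sol\<close>. In terms of the remaining speed \<open>z\<close> the equation prescribes the value of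
  \<open>legendre z\<close>, which is strictly increasing. The rate function may jump at \<open>L\<close>, so the intermediate value
  theorem is applied below a \<open>y1 < L\<close> where it exceeds \<open>l\<close>; uniqueness has to rule out speeds beyond \<open>L\<close> too.
\<close>

lemma y_sol_speed:
  fixes p :: "nat pmf"
  defines "l \<equiv> ln (offspring_mean p)"
  assumes x: "0 < x" "x < L" and a: "l - legendre x < a" "0 < a" "a < l"
    and y1: "0 < y1" "y1 < L" "l < legendre y1"
    and s: "0 < s" "s \<le> 1 - a / l"
  obtains z where "0 \<le> z" "z < L" "legendre z = l - a / (1 - s)" "y_sol p \<mu> x a s = x - (1 - s) * z"
proof -
  have l: "0 < l" using a by simp
  have s1: "s < 1" using s a l by (smt (verit) divide_pos_pos)
  define w where "w = l - a / (1 - s)"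
  have "a / l \<le> 1 - s" using s by simp
  then have "a \<le> l * (1 - s)" using l by (simp add: pos_divide_le_eq mult.commute)
  then have w0: "0 \<le> w" using s1 by (simp add: w_def pos_divide_le_eq)
  have wl: "w < l" using a s1 by (simp add: w_def)
  have "\<exists>z\<ge>0. z \<le> y1 \<and> legendre z = w"
    using y1 w0 wl legendre_nonpos[of 0]
    by (intro IVT') (auto intro!: continuous_on_subset[OF legendre_continuous])
  then obtain z where z: "0 \<le> z" "z \<le> y1" "legendre z = w" by blast
  have zL: "z < L" using z y1 by simp
  have "z < x / (1 - s)"
  proof (rule ccontr)
    assume "\<not> z < x / (1 - s)"
    then have le: "x / (1 - s) \<le> z" by simp
    have "legendre x = legendre ((1 - s) * (x / (1 - s)))" using s1 by simp
    also have "\<dots> \<le> (1 - s) * legendre (x / (1 - s))"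
      using s s1 le zL by (intro legendre_scale) auto
    also have "\<dots> \<le> (1 - s) * w"
      using legendre_mono[OF le zL] z s1 by (intro mult_left_mono) auto
    also have "\<dots> = (1 - s) * l - a" using s1 by (simp add: w_def right_diff_distrib)
    also have "\<dots> \<le> l - a" using s l by (simp add: algebra_simps)
    finally show False using a by simp
  qed
  then have pos: "0 < x - (1 - s) * z" using s1 by (simp add: field_simps)
  have "y_sol p \<mu> x a s = x - (1 - s) * z"
    unfolding y_sol_def l_def[symmetric]
  proof (rule the_equality)
    have "(x - (x - (1 - s) * z)) / (1 - s) = z" using s1 by simp
    then show "0 < x - (1 - s) * z \<and> x - (1 - s) * z \<le> x \<and>
        ereal l - rate \<mu> ((x - (x - (1 - s) * z)) / (1 - s)) = ereal (a / (1 - s))"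
      using pos z s1 by (simp add: rate_eq_legendre[OF zL] w_def)
  next
    fix y assume y: "0 < y \<and> y \<le> x \<and> ereal l - rate \<mu> ((x - y) / (1 - s)) = ereal (a / (1 - s))"
    define z' where "z' = (x - y) / (1 - s)"
    have z'0: "0 \<le> z'" using y s1 by (simp add: z'_def)
    have r: "rate \<mu> z' = ereal w"
      using y unfolding z'_def[symmetric] w_def by (cases "rate \<mu> z'") auto
    have z'L: "z' < L"
    proof (rule ccontr)
      assume "\<not> z' < L"
      then have "rate \<mu> y1 \<le> rate \<mu> z'" using y1 by (intro rate_mono) auto
      then show False using r y1 wl by (simp add: rate_eq_legendre)
    qed
    then have "legendre z' = legendre z" using r z by (simp add: rate_eq_legendre)
    then have "z' = z"
      using legendre_strict_mono[of z z'] legendre_strict_mono[of z' z] z z'0 zL z'L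
      by (metis less_irrefl not_less_iff_gr_or_eq)
    then show "y = x - (1 - s) * z" using s1 by (simp add: z'_def field_simps)
  qed
  then show ?thesis using z zL by (intro that) (auto simp: w_def)
qed

text \<open>
  The meaning of the two alternative hypotheses: a particle that runs at full speed until time \<open>s\<close> does not, on
  average, produce \<open>exp (a * n)\<close> descendants beyond \<open>x * n\<close>. Under the second one, \<open>y_sol\<close> is the position
  at which a particle would have to be at time \<open>s\<close> in order to do so, and it is out of reach. After time
  \<open>1 - a / l\<close> there are too few generations left even for particles that have already arrived.
\<close>

lemma growth_less:
  fixes p :: "nat pmf"
  defines "l \<equiv> ln (offspring_mean p)"
  assumes x: "0 < x" "x < L" and a: "l - legendre x < a" "0 < a" "a < l"
    and cond: "max_speed p \<mu> = ereal L \<or>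
      (max_speed p \<mu> < ereal L \<and> (\<forall>s. 0 < s \<and> s \<le> 1 - a / l \<longrightarrow> y_sol p \<mu> x a s / s > L))"
    and s: "0 \<le> s" "s < 1"
  shows "(1 - s) * l - remaining x s < a"
proof -
  have l: "0 < l" using a by simp
  show ?thesis
    using cond
  proof
    assume max: "max_speed p \<mu> = ereal L"
    have "legendre y \<le> l" if y: "y < L" for y
    proof -
      have "ereal y < max_speed p \<mu>" using max y by simp
      then obtain y' where y': "y < y'" "rate \<mu> y' \<le> ereal l"
        unfolding max_speed_def l_def by (auto simp: less_Sup_iff)
      then have "rate \<mu> y \<le> ereal l" using rate_mono[of y y'] by (meson less_imp_le order_trans)
      then show ?thesis using y by (simp add: rate_eq_legendre)
    qed
    then have "(1 - s) * l - remaining x s \<le> l - legendre x"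
      using x s by (intro growth_less_of_max_speed_eq) auto
    then show ?thesis using a by simp
  next
    assume B: "max_speed p \<mu> < ereal L \<and> (\<forall>s. 0 < s \<and> s \<le> 1 - a / l \<longrightarrow> y_sol p \<mu> x a s / s > L)"
    consider "s = 0" | "1 - a / l < s" | "0 < s" "s \<le> 1 - a / l" using s by linarith
    then show ?thesis
    proof cases
      case 1
      then show ?thesis using a by (simp add: remaining_0)
    next
      case 2
      then have "(1 - s) * l < a / l * l" using l by (intro mult_strict_right_mono) auto
      then show ?thesis using remaining_nonneg[OF x(2) s(2)] l by simp
    next
      case 3
      obtain y1 where y1: "max_speed p \<mu> < ereal y1" "ereal y1 < ereal L"
        using B ereal_dense2 by blast
      have 0: "ereal 0 \<le> max_speed p \<mu>"
        unfolding max_speed_def using l L_pos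
        by (intro Sup_upper) (auto simp: rate_eq_legendre legendre_nonpos l_def)
      then have "ereal 0 < ereal y1" using y1(1) by (rule le_less_trans)
      then have y10: "0 < y1" by simp
      have "\<not> rate \<mu> y1 \<le> ereal l"
      proof
        assume "rate \<mu> y1 \<le> ereal l"
        then have "ereal y1 \<le> max_speed p \<mu>"
          unfolding max_speed_def l_def using y10 by (intro Sup_upper) auto
        then show False using y1 by simp
      qed
      then have "l < legendre y1" using y1 by (simp add: rate_eq_legendre)
      with y1 y10 obtain z where z: "0 \<le> z" "z < L" "legendre z = l - a / (1 - s)"
          "y_sol p \<mu> x a s = x - (1 - s) * z"
        using y_sol_speed[of x p a y1 s] x a 3 unfolding l_def by auto
      have "L < (x - (1 - s) * z) / s" using B 3 z(4) by metis
      then have "s * L < x - (1 - s) * z" using 3 by (simp add: field_simps)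
      then have "z < (x - s * L) / (1 - s)" using s by (simp add: field_simps)
      then have "legendre z < legendre ((x - s * L) / (1 - s))"
        using z x s by (intro legendre_strict_mono speed_less_L) auto
      then have "(1 - s) * (l - a / (1 - s)) < remaining x s"
        unfolding remaining_def z(3)[symmetric] using s by (intro mult_strict_left_mono) auto
      then show ?thesis using s by (simp add: right_diff_distrib)
    qed
  qed
qed

text \<open>
  A uniform gap below \<open>a\<close>: by compactness up to time \<open>x / L\<close>, and by monotonicity afterwards, when the
  remaining cost vanishes.
\<close>

lemma growth_bound:
  fixes p :: "nat pmf"
  defines "l \<equiv> ln (offspring_mean p)"
  assumes x: "0 < x" "x < L" and a: "l - legendre x < a" "0 < a" "a < l"
    and cond: "max_speed p \<mu> = ereal L \<or>
      (max_speed p \<mu> < ereal L \<and> (\<forall>s. 0 < s \<and> s \<le> 1 - a / l \<longrightarrow> y_sol p \<mu> x a s / s > L))"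
  obtains \<gamma> where "0 \<le> \<gamma>" "\<gamma> < a"
    "\<And>s. 0 \<le> s \<Longrightarrow> s < 1 \<Longrightarrow> (1 - s) * (l - legendre ((x - s * L) / (1 - s))) \<le> \<gamma>"
proof -
  define h where "h s = (1 - s) * l - remaining x s" for s
  have l: "0 < l" using a by simp
  have xL: "0 < x / L" "x / L < 1" using x by auto
  have sub: "{0..x / L} \<subseteq> {..<1}" using xL(2) by (auto simp only: atLeastAtMost_iff lessThan_iff intro: le_less_trans)
  have "continuous_on {0..x / L} h"
    unfolding h_def using x sub
    by (intro continuous_intros continuous_on_subset[OF remaining_continuous]) simp_all
  then obtain s0 where s0: "s0 \<in> {0..x / L}" "\<And>s. s \<in> {0..x / L} \<Longrightarrow> h s \<le> h s0"
    using continuous_attains_sup[of "{0..x / L}" h] xL by auto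
  show ?thesis
  proof (rule that[of "h s0"])
    have "0 \<le> h (x / L)" using remaining_eq_0[of x "x / L"] x xL l by (simp add: h_def)
    also have "\<dots> \<le> h s0" using xL by (intro s0) auto
    finally show "0 \<le> h s0" .
    have "s0 < 1" using s0(1) sub by blast
    then show "h s0 < a"
      unfolding h_def l_def using s0 xL growth_less[of x p a s0] x a cond by (auto simp: l_def)
    fix s :: real assume s: "0 \<le> s" "s < 1"
    have "h s \<le> h s0"
    proof (cases "s \<le> x / L")
      case True
      then show ?thesis using s by (intro s0) auto
    next
      case False
      have "h s = (1 - s) * l" using remaining_eq_0[of x s] x s False by (simp add: h_def)
      also have "\<dots> \<le> (1 - x / L) * l" using False l by (intro mult_right_mono) auto
      also have "\<dots> = h (x / L)" using remaining_eq_0[of x "x / L"] x xL by (simp add: h_def)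
      also have "\<dots> \<le> h s0" using xL by (intro s0) auto
      finally show ?thesis .
    qed
    then show "(1 - s) * (l - legendre ((x - s * L) / (1 - s))) \<le> h s0"
      by (simp add: h_def remaining_def right_diff_distrib)
  qed
qed

lemma solves_c_eq_iff:
  assumes x: "0 < x" "x < L" and c: "0 < c" "c < x / L"
  shows "solves_c_eq p \<mu> L x a c \<longleftrightarrow>
    c * ln (real (b_val p)) + (1 - c) * ln (offspring_mean p) - remaining x c = a"
proof -
  have "x / L < 1" using x by simp
  then have c1: "c < 1" using c by simp
  have eq: "L + (x - L) / (1 - c) = (x - c * L) / (1 - c)"
    using c1 by (simp add: field_simps)
  define J where "J = legendre ((x - c * L) / (1 - c))"
  define B where "B = ln (real (b_val p))"
  define l where "l = ln (offspring_mean p)"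
  have "solves_c_eq p \<mu> L x a c \<longleftrightarrow> l - J - (a - B) / (1 - c) = B"
    unfolding solves_c_eq_def eq using rate_eq_legendre[OF speed_less_L[OF x(2) c1]]
    by (simp add: J_def B_def l_def)
  also have "\<dots> \<longleftrightarrow> c * B + (1 - c) * l - (1 - c) * J = a"
    using c1 by (simp add: field_simps)
  finally show ?thesis by (simp add: J_def B_def l_def remaining_def)
qed

text \<open>
  The exponent \<open>g c\<close> of the forcing strategy is concave, starts below \<open>a\<close> and ends above \<open>a\<close> at \<open>x / L\<close>.
  A concave function that has reached \<open>a\<close> and lies above \<open>a\<close> at the right end stays above \<open>a\<close> in between;
  this gives uniqueness, and also the strict inequality to the right of the solution.
\<close>

lemma critical_time:
  fixes l B a :: real
  assumes x: "0 < x" "x < L" and a: "l - legendre x < a" "a < l" "l \<le> B"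
  defines "g \<equiv> \<lambda>c. c * B + (1 - c) * l - remaining x c"
  obtains c where "0 < c" "c < x / L" "g c = a"
    "\<And>c'. c < c' \<Longrightarrow> c' \<le> x / L \<Longrightarrow> a < g c'" "\<And>c'. 0 < c' \<Longrightarrow> c' < x / L \<Longrightarrow> g c' = a \<Longrightarrow> c' = c"
proof -
  have xL: "0 < x / L" "x / L < 1" using x by auto
  have sub: "{0..x / L} \<subseteq> {..<1}" using xL(2) by (auto simp only: atLeastAtMost_iff lessThan_iff intro: le_less_trans)
  have fin: "a < g (x / L)"
  proof -
    have "l = x / L * l + (1 - x / L) * l" by (simp add: algebra_simps)
    also have "\<dots> \<le> x / L * B + (1 - x / L) * l"
      using a xL by (intro add_right_mono mult_left_mono) auto
    also have "\<dots> = g (x / L)" using remaining_eq_0[of x "x / L"] x xL by (simp add: g_def)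
    finally show ?thesis using a by simp
  qed
  have start: "g 0 < a" using a by (simp add: g_def remaining_0)
  have cont: "continuous_on {0..x / L} g"
    unfolding g_def using x sub
    by (intro continuous_intros continuous_on_subset[OF remaining_continuous]) simp_all
  have above: "a < g c'" if c: "0 \<le> c" "g c = a" "c < c'" "c' \<le> x / L" for c c'
  proof -
    define u where "u = (c' - c) / (x / L - c)"
    have u: "0 < u" "u \<le> 1" using c by (auto simp: u_def)
    have c': "c' = (1 - u) * c + u * (x / L)"
    proof -
      have "u * (x / L - c) = c' - c" using c by (simp add: u_def)
      then show ?thesis by (simp add: algebra_simps)
    qed
    have mem: "c \<in> {..<1}" "x / L \<in> {..<1}"
      unfolding lessThan_iff using c(3,4) xL(2) by linarith+
    have "remaining x ((1 - u) *\<^sub>R c + u *\<^sub>R (x / L)) \<le> (1 - u) * remaining x c + u * remaining x (x / L)"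
      using u by (intro convex_onD[OF remaining_convex[OF x(2)] _ _ mem]) auto
    then have "(1 - u) * g c + u * g (x / L) \<le> g c'"
      unfolding g_def by (simp add: c' algebra_simps)
    moreover have "(1 - u) * a + u * a < (1 - u) * g c + u * g (x / L)"
      using u c fin by simp
    ultimately show ?thesis by (simp add: algebra_simps)
  qed
  obtain c where c: "0 \<le> c" "c \<le> x / L" "g c = a"
    using IVT'[of g 0 a "x / L"] start fin cont xL by auto
  have c': "0 < c" "c < x / L"
    using c start fin by (auto simp: order_less_le)
  show ?thesis
  proof (rule that[OF c' c(3)])
    show "a < g c'" if "c < c'" "c' \<le> x / L" for c' using above[of c c'] c that by auto
    show "d = c" if "0 < d" "d < x / L" "g d = a" for d
      using above[of c d] above[of d c] c c' that by (cases d c rule: linorder_cases) auto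
  qed
qed

end

section \<open>Upper bound on the probability\<close>

lemma nn_integral_real_pmf:
  assumes "summable (\<lambda>k. real k * pmf p k)"
  shows "(\<integral>\<^sup>+k. ennreal (real k) \<partial>measure_pmf p) = ennreal (offspring_mean p)"
proof -
  have "(\<integral>\<^sup>+k. ennreal (real k) \<partial>measure_pmf p) = (\<Sum>k. ennreal (pmf p k) * ennreal (real k))"
    by (simp add: nn_integral_measure_pmf nn_integral_count_space_nat)
  also have "\<dots> = (\<Sum>k. ennreal (real k * pmf p k))"
    by (simp add: ennreal_mult mult.commute)
  also have "\<dots> = ennreal (offspring_mean p)"
    unfolding offspring_mean_def by (rule suminf_ennreal2) (auto intro: assms)
  finally show ?thesis .
qed

locale bounded_brw = branching_random_walk M p \<mu> N D + bounded_step \<mu> L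
  for M :: "'w measure" and p \<mu> N D and L :: real +
  fixes \<theta> :: real
  assumes mean_summable: "summable (\<lambda>k. real k * pmf p k)"
    and mean_gt_1: "1 < offspring_mean p"
    and \<theta>_pos: "0 < \<theta>"
    and exp_integrable: "(\<integral>\<^sup>+k. ennreal (exp (\<theta> * real k)) \<partial>measure_pmf p) < \<infinity>"
begin

abbreviation "m \<equiv> offspring_mean p"

lemma nn_integral_offspring: "(\<integral>\<^sup>+k. ennreal (real k) \<partial>measure_pmf p) = ennreal m"
  by (rule nn_integral_real_pmf[OF mean_summable])

text \<open>
  The logarithmic moment generating function of the offspring number has slope \<open>m\<close> at \<open>0\<close>; the
  second-order term \<open>s\<^sup>2 * k\<^sup>2 * exp (s * k)\<close> is dominated by \<open>exp (\<theta> * k)\<close> for \<open>s \<le> \<theta> / 2\<close>.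
\<close>

lemma offspring_exp_bound:
  assumes "0 < \<epsilon>"
  obtains s0 where "0 < s0"
    "\<And>s. 0 \<le> s \<Longrightarrow> s \<le> s0 \<Longrightarrow>
      (\<integral>\<^sup>+k. ennreal (exp s) ^ k \<partial>measure_pmf p) \<le> ennreal (exp (m * (1 + \<epsilon>) * s))"
proof -
  define K where "K = enn2real (\<integral>\<^sup>+k. ennreal (exp (\<theta> * real k)) \<partial>measure_pmf p)"
  have K: "0 \<le> K" "(\<integral>\<^sup>+k. ennreal (exp (\<theta> * real k)) \<partial>measure_pmf p) = ennreal K"
    using exp_integrable by (simp_all add: K_def)
  define B where "B = 4 / \<theta>\<^sup>2"
  have B: "0 < B" using \<theta>_pos by (simp add: B_def)
  define s0 where "s0 = min (\<theta> / 2) (m * \<epsilon> / (B * K + 1))"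
  have BK: "0 < B * K + 1" using B K by (simp add: add_nonneg_pos)
  have s0_le: "s0 \<le> \<theta> / 2" "s0 \<le> m * \<epsilon> / (B * K + 1)" by (simp_all only: s0_def min.cobounded1 min.cobounded2)
  show ?thesis
  proof (rule that)
    have "0 < m * \<epsilon> / (B * K + 1)" using mean_gt_1 assms BK by (intro divide_pos_pos mult_pos_pos) simp_all
    then show "0 < s0" using \<theta>_pos by (simp only: s0_def min_less_iff_conj) simp
    fix s assume s: "0 \<le> s" "s \<le> s0"
    have pt: "exp (s * real k) \<le> 1 + s * real k + s\<^sup>2 * B * exp (\<theta> * real k)" for k
    proof -
      define u where "u = s * real k"
      have "s \<le> \<theta> / 2" using s s0_le(1) by linarith
      then have u: "0 \<le> u" "u \<le> \<theta> / 2 * real k"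
        unfolding u_def using s by (simp, intro mult_right_mono) simp_all
      obtain v where v: "\<bar>v\<bar> \<le> \<bar>u\<bar>" and e: "exp u = 1 + u + exp v / 2 * u\<^sup>2"
        using Maclaurin_exp_le[of u 2] by (auto simp: numeral_2_eq_2)
      define q where "q = \<theta> / 2 * real k"
      have q: "0 \<le> q" using \<theta>_pos by (simp add: q_def)
      have "1 + q + q\<^sup>2 / 2 \<le> exp q" using q by (rule exp_lower_Taylor_quadratic)
      then have q2: "q\<^sup>2 / 2 \<le> exp q" using q by linarith
      have "exp v / 2 * u\<^sup>2 = s\<^sup>2 * B * (exp v * (q\<^sup>2 / 2))"
        using \<theta>_pos by (simp add: u_def B_def q_def power_mult_distrib power_divide)
      also have "\<dots> \<le> s\<^sup>2 * B * (exp q * exp q)"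
        using v u q2 B by (intro mult_left_mono mult_mono) (auto simp: q_def)
      also have "\<dots> = s\<^sup>2 * B * exp (\<theta> * real k)" by (simp add: q_def exp_add[symmetric])
      finally show ?thesis unfolding u_def[symmetric] e by simp
    qed
    have "(\<integral>\<^sup>+k. ennreal (exp s) ^ k \<partial>measure_pmf p) = (\<integral>\<^sup>+k. ennreal (exp (s * real k)) \<partial>measure_pmf p)"
      by (simp add: ennreal_power exp_of_nat2_mult)
    also have "\<dots> \<le> (\<integral>\<^sup>+k. 1 + (ennreal s * ennreal (real k) + ennreal (s\<^sup>2 * B) * ennreal (exp (\<theta> * real k))) \<partial>measure_pmf p)"
    proof (rule nn_integral_mono)
      fix k
      have "ennreal (exp (s * real k)) \<le> ennreal (1 + (s * real k + s\<^sup>2 * B * exp (\<theta> * real k)))"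
        using pt[of k] by (intro ennreal_leI) simp
      also have "\<dots> = 1 + (ennreal s * ennreal (real k) + ennreal (s\<^sup>2 * B) * ennreal (exp (\<theta> * real k)))"
      proof -
        have "0 \<le> s * real k" "0 \<le> s\<^sup>2 * B * exp (\<theta> * real k)" "0 \<le> s\<^sup>2 * B" using s B by simp_all
        then show ?thesis using s by (simp only: ennreal_plus add_nonneg_nonneg ennreal_1 ennreal_mult
          zero_le_one of_nat_0_le_iff exp_ge_zero)
      qed
      finally show "ennreal (exp (s * real k)) \<le>
        1 + (ennreal s * ennreal (real k) + ennreal (s\<^sup>2 * B) * ennreal (exp (\<theta> * real k)))" .
    qed
    also have "\<dots> = 1 + (ennreal s * ennreal m + ennreal (s\<^sup>2 * B) * ennreal K)"
      by (simp add: nn_integral_add nn_integral_cmult nn_integral_offspring K(2))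
    also have "\<dots> = ennreal (1 + (s * m + s\<^sup>2 * B * K))"
      using s B K mean_gt_1 by (simp add: ennreal_plus ennreal_mult)
    also have "\<dots> \<le> ennreal (exp (m * (1 + \<epsilon>) * s))"
    proof (rule ennreal_leI)
      have "s * (B * K) \<le> s * (B * K + 1)" using s by (simp add: mult_left_mono)
      also have "\<dots> \<le> m * \<epsilon>" using order_trans[OF s(2) s0_le(2)] BK by (simp only: pos_le_divide_eq)
      finally have "s * (s * (B * K)) \<le> s * (m * \<epsilon>)" using s by (intro mult_left_mono)
      then have "s * m + s\<^sup>2 * B * K \<le> m * (1 + \<epsilon>) * s" by (simp add: algebra_simps power2_eq_square)
      then show "1 + (s * m + s\<^sup>2 * B * K) \<le> exp (m * (1 + \<epsilon>) * s)"
        using exp_ge_add_one_self[of "m * (1 + \<epsilon>) * s"] by linarith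
    qed
    finally show "(\<integral>\<^sup>+k. ennreal (exp s) ^ k \<partial>measure_pmf p) \<le> ennreal (exp (m * (1 + \<epsilon>) * s))" .
  qed
qed

lemma success_le_exp_moment:
  assumes "0 \<le> \<beta>"
  shows "ennreal (success n y w) \<le> ennreal (exp (- \<beta> * w)) * exp_moment \<beta> n y"
proof -
  have "ennreal (success n y w) = (\<integral>\<^sup>+f. indicator {f \<in> space law. w \<le> real (descendants n y f)} f \<partial>law)"
    unfolding success_def by (subst nn_integral_indicator) (auto simp: law.emeasure_eq_measure)
  also have "\<dots> \<le> (\<integral>\<^sup>+f. ennreal (exp (- \<beta> * w)) * ennreal (exp (\<beta> * real (descendants n y f))) \<partial>law)"
  proof (rule nn_integral_mono)
    fix f
    have "ennreal 1 \<le> ennreal (exp (- \<beta> * w + \<beta> * real (descendants n y f)))" if "w \<le> real (descendants n y f)"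
      using assms that by (intro ennreal_leI) (simp add: mult_left_mono)
    then show "indicator {f \<in> space law. w \<le> real (descendants n y f)} f \<le>
        ennreal (exp (- \<beta> * w)) * ennreal (exp (\<beta> * real (descendants n y f)))"
      by (auto simp: ennreal_mult[symmetric] exp_add[symmetric] split: split_indicator)
  qed
  also have "\<dots> = ennreal (exp (- \<beta> * w)) * exp_moment \<beta> n y"
    unfolding exp_moment_def by (rule nn_integral_cmult) measurable
  finally show ?thesis .
qed

text \<open>
  The hypothesis on \<open>\<gamma>\<close> bounds by \<open>exp (\<gamma> * n)\<close> the expected contribution of any single particle, at any
  generation and any place it can have reached. Hence \<open>exp_moment_le\<close> applies with \<open>\<beta>\<close> of order \<open>exp (- \<gamma> * n)\<close>,
  and the exponential Markov inequality at level \<open>exp (a * n)\<close> has the double exponential gain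
  \<open>exp (- \<beta> * exp (a * n))\<close>. Half of the gap \<open>a - \<gamma>\<close> is spent on replacing \<open>m\<close> by \<open>\<rho>\<close>.
\<close>

lemma double_exponential_decay:
  assumes x: "x < L" and \<gamma>: "0 \<le> \<gamma>" "\<gamma> < a"
    and h: "\<And>s. 0 \<le> s \<Longrightarrow> s < 1 \<Longrightarrow> (1 - s) * (ln m - legendre ((x - s * L) / (1 - s))) \<le> \<gamma>"
  obtains \<eta> where "0 < \<eta>"
    "\<forall>\<^sub>F n in sequentially. success n (x * real n) (exp (a * real n)) \<le> exp (- exp (\<eta> * real n))"
proof -
  define \<sigma> where "\<sigma> = (a - \<gamma>) / 2"
  have \<sigma>: "0 < \<sigma>" using \<gamma> by (simp add: \<sigma>_def)
  define \<epsilon> where "\<epsilon> = exp (\<sigma> / 2) - 1"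
  have \<epsilon>: "0 < \<epsilon>" using \<sigma> by (simp add: \<epsilon>_def)
  obtain s0 where s0: "0 < s0" "\<And>s. 0 \<le> s \<Longrightarrow> s \<le> s0 \<Longrightarrow>
      (\<integral>\<^sup>+k. ennreal (exp s) ^ k \<partial>measure_pmf p) \<le> ennreal (exp (m * (1 + \<epsilon>) * s))"
    using offspring_exp_bound[OF \<epsilon>] by blast
  define \<delta> where "\<delta> = min 1 (min (s0 / 2) \<epsilon>)"
  have \<delta>: "0 < \<delta>" "\<delta> \<le> 1" "2 * \<delta> \<le> s0" "\<delta> \<le> \<epsilon>" using s0 \<epsilon> by (auto simp: \<delta>_def)
  define \<rho> where "\<rho> = exp (ln m + \<sigma>)"
  have \<rho>_eq: "\<rho> = (1 + \<epsilon>) * (m * (1 + \<epsilon>))"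
  proof -
    have "(1 + \<epsilon>) * (1 + \<epsilon>) = exp \<sigma>" by (simp add: \<epsilon>_def exp_add[symmetric])
    then show ?thesis using mean_gt_1 by (simp add: \<rho>_def exp_add mult.left_commute)
  qed
  have main: "success n (x * real n) (exp (a * real n)) \<le> exp (\<delta> - \<delta> * exp (\<sigma> * real n))" if n: "0 < n" for n
  proof -
    define \<beta> where "\<beta> = \<delta> * exp (- (\<sigma> + \<gamma>) * real n)"
    have \<beta>: "0 \<le> \<beta>" using \<delta> by (simp add: \<beta>_def)
    have small: "\<beta> * \<rho> ^ j * tail \<mu> j (x * real n - real n * L + real j * L) \<le> \<delta>" if j: "j \<le> n" for j
    proof (cases "j = 0")
      case True
      have "- (\<sigma> + \<gamma>) * real n \<le> 0" using \<sigma> \<gamma> by (intro mult_nonpos_nonneg) auto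
      then have "\<beta> \<le> \<delta>" using \<delta> unfolding \<beta>_def by (intro mult_left_le) auto
      then have "\<beta> * tail \<mu> 0 (x * real n - real n * L) \<le> \<delta> * 1"
        using \<beta> \<delta> by (intro mult_mono) (auto simp: step.tail_le_1 step.tail_nonneg)
      then show ?thesis using True by simp
    next
      case False
      then have j0: "0 < j" by simp
      \<comment> \<open>The time at which \<open>j\<close> generations are left.\<close>
      define s where "s = 1 - real j / real n"
      have s: "0 \<le> s" "s < 1" using j j0 n by (auto simp: s_def)
      define z where "z = (x - s * L) / (1 - s)"
      have z: "z < L"
      proof -
        have "x - s * L < L * (1 - s)" using x by (simp add: algebra_simps)
        then show ?thesis using s by (simp add: z_def pos_divide_less_eq)
      qed
      have jz: "x * real n - real n * L + real j * L = real j * z"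
        using j0 n by (simp add: z_def s_def field_simps)
      have "tail \<mu> j (real j * z) \<le> exp (- real j * legendre z)" by (rule chernoff[OF j0 z])
      then have "\<beta> * \<rho> ^ j * tail \<mu> j (real j * z) \<le> \<beta> * \<rho> ^ j * exp (- real j * legendre z)"
        using \<beta> by (intro mult_left_mono) (auto simp: \<rho>_def)
      also have "\<dots> = \<delta> * exp (real j * (ln m - legendre z) - \<gamma> * real n - \<sigma> * (real n - real j))"
        by (simp add: \<beta>_def \<rho>_def exp_of_nat_mult[symmetric] exp_add[symmetric] algebra_simps)
      also have "\<dots> \<le> \<delta> * exp 0"
      proof -
        have "real n * ((1 - s) * (ln m - legendre z)) \<le> real n * \<gamma>"
          unfolding z_def using h[OF s] by (intro mult_left_mono) auto
        then have "real j * (ln m - legendre z) \<le> \<gamma> * real n" using n by (simp add: s_def algebra_simps)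
        moreover have "0 \<le> \<sigma> * (real n - real j)" using \<sigma> j by simp
        ultimately show ?thesis using \<delta> by (intro mult_left_mono) auto
      qed
      finally show ?thesis unfolding jz by simp
    qed
    have "exp_moment \<beta> n (x * real n) \<le> ennreal (exp (\<beta> * \<rho> ^ n * tail \<mu> n (x * real n)))"
    proof (rule exp_moment_le[where L = L and \<delta> = \<delta> and n = n and Y = "x * real n - real n * L" and \<tau> = "m * (1 + \<epsilon>)"])
      show "0 \<le> m * (1 + \<epsilon>)" using mean_gt_1 \<epsilon> by simp
      show "(1 + \<delta>) * (m * (1 + \<epsilon>)) \<le> \<rho>"
        unfolding \<rho>_eq using mean_gt_1 \<epsilon> \<delta> by (intro mult_right_mono) auto
      show "(\<integral>\<^sup>+k. ennreal (exp s) ^ k \<partial>measure_pmf p) \<le> ennreal (exp (m * (1 + \<epsilon>) * s))"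
        if "0 \<le> s" "s \<le> 2 * \<delta>" for s using that \<delta> by (intro s0) auto
    qed (use \<beta> \<delta> in \<open>simp_all add: bounded small\<close>)
    also have "\<dots> \<le> ennreal (exp \<delta>)"
      using small[of n] by (intro ennreal_leI) simp
    finally have em: "exp_moment \<beta> n (x * real n) \<le> ennreal (exp \<delta>)" .
    have be: "\<beta> * exp (a * real n) = \<delta> * exp (\<sigma> * real n)"
    proof -
      have "- (\<sigma> + \<gamma>) * real n + a * real n = \<sigma> * real n" by (simp add: \<sigma>_def field_simps)
      then show ?thesis by (simp add: \<beta>_def exp_add[symmetric])
    qed
    have "ennreal (success n (x * real n) (exp (a * real n))) \<le>
        ennreal (exp (- \<beta> * exp (a * real n))) * exp_moment \<beta> n (x * real n)"
      by (rule success_le_exp_moment[OF \<beta>])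
    also have "\<dots> \<le> ennreal (exp (- \<beta> * exp (a * real n))) * ennreal (exp \<delta>)"
      using em by (rule mult_left_mono) simp
    also have "\<dots> = ennreal (exp (\<delta> - \<delta> * exp (\<sigma> * real n)))"
      by (simp add: ennreal_mult[symmetric] exp_add[symmetric] be)
    finally show ?thesis by simp
  qed
  have "\<forall>\<^sub>F n in sequentially. exp (\<sigma> / 2 * real n) \<le> \<delta> * exp (\<sigma> * real n) - \<delta>"
    using \<sigma> \<delta> by real_asymp
  moreover have "\<forall>\<^sub>F n :: nat in sequentially. 0 < n" by (rule eventually_gt_at_top)
  ultimately have "\<forall>\<^sub>F n in sequentially. success n (x * real n) (exp (a * real n)) \<le> exp (- exp (\<sigma> / 2 * real n))"
  proof eventually_elim
    case (elim n)
    then show ?case by (intro order_trans[OF main]) auto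
  qed
  then show ?thesis using \<sigma> by (intro that[of "\<sigma> / 2"]) auto
qed

text \<open>
  A subtree reaches half of its expected count with a probability that is only exponentially small in \<open>r\<close>. The
  moment bound that this needs is \<open>exp_moment_le\<close> with \<open>\<beta> = \<delta> / \<rho> ^ r\<close>, for which smallness is
  automatic since tails are at most one.
\<close>

lemma success_base:
  obtains \<delta> \<rho> where "0 < \<delta>" "1 \<le> \<rho>"
    "\<And>r y e. 0 < e \<Longrightarrow> e \<le> m ^ r * tail \<mu> r y \<Longrightarrow> e\<^sup>2 * (\<delta> / \<rho> ^ r)\<^sup>2 / (32 * exp 1) \<le> success r y (e / 2)"
proof -
  obtain s0 where s0: "0 < s0" "\<And>s. 0 \<le> s \<Longrightarrow> s \<le> s0 \<Longrightarrow>
      (\<integral>\<^sup>+k. ennreal (exp s) ^ k \<partial>measure_pmf p) \<le> ennreal (exp (m * (1 + 1) * s))"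
    using offspring_exp_bound[of 1] by auto
  define \<delta> where "\<delta> = min 1 (s0 / 2)"
  have \<delta>: "0 < \<delta>" "\<delta> \<le> 1" "2 * \<delta> \<le> s0" using s0 by (auto simp: \<delta>_def)
  define \<rho> where "\<rho> = 4 * m"
  have \<rho>: "1 \<le> \<rho>" using mean_gt_1 by (simp add: \<rho>_def)
  have "e\<^sup>2 * (\<delta> / \<rho> ^ r)\<^sup>2 / (32 * exp 1) \<le> success r y (e / 2)"
    if e: "0 < e" "e \<le> m ^ r * tail \<mu> r y" for r y e
    unfolding success_def
  proof (rule law.paley_zygmund_exp)
    define \<beta> where "\<beta> = \<delta> / \<rho> ^ r"
    show \<beta>: "0 < \<delta> / \<rho> ^ r" using \<delta> \<rho> by simp
    have small: "\<beta> * \<rho> ^ j * tail \<mu> j (y - real r * L + real j * L) \<le> \<delta>" if "j \<le> r" for j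
    proof -
      have "\<beta> * \<rho> ^ j \<le> \<beta> * \<rho> ^ r" using \<beta> \<rho> that by (intro mult_left_mono power_increasing) (auto simp: \<beta>_def)
      also have "\<dots> = \<delta>" using \<rho> by (simp add: \<beta>_def)
      finally have "\<beta> * \<rho> ^ j * tail \<mu> j (y - real r * L + real j * L) \<le> \<delta> * 1"
        using \<delta> by (intro mult_mono) (auto simp: step.tail_le_1 step.tail_nonneg)
      then show ?thesis by simp
    qed
    have "exp_moment \<beta> r y \<le> ennreal (exp (\<beta> * \<rho> ^ r * tail \<mu> r y))"
    proof (rule exp_moment_le[where L = L and \<delta> = \<delta> and n = r and Y = "y - real r * L" and \<tau> = "m * (1 + 1)"])
      show "(1 + \<delta>) * (m * (1 + 1)) \<le> \<rho>"
        using mult_right_mono[of "1 + \<delta>" 2 "2 * m"] mean_gt_1 \<delta> by (simp add: \<rho>_def)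
      show "(\<integral>\<^sup>+k. ennreal (exp s) ^ k \<partial>measure_pmf p) \<le> ennreal (exp (m * (1 + 1) * s))"
        if "0 \<le> s" "s \<le> 2 * \<delta>" for s using that \<delta> by (intro s0) auto
    qed (use \<beta> \<delta> mean_gt_1 in \<open>simp_all add: bounded small \<beta>_def[symmetric]\<close>)
    also have "\<dots> \<le> ennreal (exp 1)"
      using small[of r] \<delta> by (intro ennreal_leI) simp
    finally show "(\<integral>\<^sup>+f. exp (\<delta> / \<rho> ^ r * real (descendants r y f)) \<partial>law) \<le> ennreal (exp 1)"
      unfolding exp_moment_def \<beta>_def .
    have "ennreal (m ^ r * tail \<mu> r y) = (\<integral>\<^sup>+f. ennreal (real (descendants r y f)) \<partial>law)"
      using mean_gt_1 step.tail_nonneg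
      by (simp add: nn_integral_descendants nn_integral_offspring ennreal_mult ennreal_power)
    then show "ennreal e \<le> (\<integral>\<^sup>+f. ennreal (real (descendants r y f)) \<partial>law)"
      using e(2) by (metis ennreal_leI)
  qed (use e in auto)
  with \<delta> \<rho> show ?thesis by (intro that)
qed

end

section \<open>Lower bound on the probability\<close>

context bounded_brw
begin

lemma success_mono:
  assumes "y' \<le> y" "w' \<le> w"
  shows "success n y w \<le> success n y' w'"
proof -
  have "w' \<le> real (descendants n y' f)" if "w \<le> real (descendants n y f)" for f
    using descendants_antimono[OF assms(1), of n f] assms(2) that by linarith
  moreover have "{f \<in> space law. w' \<le> real (descendants n y' f)} \<in> sets law"
  proof -
    have "Measurable.pred law (\<lambda>f. w' \<le> real (descendants n y' f))" by measurable
    then show ?thesis by (simp add: pred_def)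
  qed
  ultimately show ?thesis
    unfolding success_def by (intro law.finite_measure_mono) auto
qed

text \<open>
  Forcing: for the first \<open>\<lceil>c * n\<rceil>\<close> generations every particle has \<open>b\<close> children and every displacement is close to
  \<open>L\<close>. Thereafter each of the \<open>b ^ \<lceil>c * n\<rceil>\<close> subtrees only has to reach half of its expected count. The latter has
  probability at least \<open>exp (- O(n))\<close>, so that everything together costs \<open>b ^ \<lceil>c * n\<rceil> * O(n)\<close>. The exponent
  \<open>ln m - legendre z\<close> of a single subtree may be negative; the subtree then has to contribute a single particle,
  which it does with probability at least \<open>exp (- O(n))\<close> as well.
\<close>

lemma double_exponential_attained:
  fixes b :: nat
  assumes b: "2 \<le> b" "m \<le> real b" "0 < pmf p b"
    and x: "x < L" and c: "0 < c" "c < 1" "c * L < x"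
    and a: "a < c * ln (real b) + (1 - c) * ln m - remaining x c"
  obtains A B where "0 < A" "1 \<le> B"
    "\<forall>\<^sub>F n in sequentially. 0 < success n (x * real n) (exp (a * real n)) \<and>
      - ln (success n (x * real n) (exp (a * real n))) \<le> real b ^ nat \<lceil>c * real n\<rceil> * (A * real n + B)"
proof -
  \<comment> \<open>The speed needed in the free generations.\<close>
  define z where "z = (x - c * L) / (1 - c)"
  have z: "0 < z" "z < L" using c x by (auto simp: z_def intro: speed_less_L)
  have xz: "x = c * L + (1 - c) * z" using c by (simp add: z_def)
  define lb where "lb = ln (real b)"
  have lb: "0 < lb" "ln m \<le> lb" using b mean_gt_1 by (auto simp: lb_def)
  have "((\<lambda>\<delta>. (1 - c) * (legendre (z + 2 * \<delta>) + \<delta>)) \<longlongrightarrow> (1 - c) * (legendre (z + 2 * 0) + 0)) (at_right 0)"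
  proof (intro tendsto_intros)
    have "isCont legendre (z + 2 * 0)"
      using z legendre_continuous by (simp add: continuous_on_eq_continuous_at)
    moreover have "((\<lambda>\<delta>. z + 2 * \<delta>) \<longlongrightarrow> z + 2 * 0) (at_right 0)" by (intro tendsto_intros)
    ultimately show "((\<lambda>\<delta>. legendre (z + 2 * \<delta>)) \<longlongrightarrow> legendre (z + 2 * 0)) (at_right 0)"
      by (rule isCont_tendsto_compose)
  qed
  moreover have "(1 - c) * (legendre (z + 2 * 0) + 0) < c * lb + (1 - c) * ln m - a"
    using a by (simp add: remaining_def z_def lb_def)
  ultimately have "\<forall>\<^sub>F \<delta> in at_right 0. (1 - c) * (legendre (z + 2 * \<delta>) + \<delta>) < c * lb + (1 - c) * ln m - a"
    by (rule order_tendstoD)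
  moreover have "\<forall>\<^sub>F \<delta> in at_right 0. \<delta> < (L - z) / 2"
    using z by (intro order_tendstoD(2)[OF tendsto_ident_at]) auto
  moreover have "\<forall>\<^sub>F \<delta> :: real in at_right 0. 0 < \<delta>" by (rule eventually_at_right_less)
  ultimately have "\<forall>\<^sub>F \<delta> in at_right 0. (1 - c) * (legendre (z + 2 * \<delta>) + \<delta>) < c * lb + (1 - c) * ln m - a \<and>
      \<delta> < (L - z) / 2 \<and> 0 < \<delta>"
    by eventually_elim auto
  then obtain \<delta> where \<delta>: "(1 - c) * (legendre (z + 2 * \<delta>) + \<delta>) < c * lb + (1 - c) * ln m - a"
      "\<delta> < (L - z) / 2" "0 < \<delta>"
    using eventually_happens[of _ "at_right (0::real)"] trivial_limit_at_right_real by blast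
  \<comment> \<open>The exponent of a subtree, with the losses from all approximations; \<open>z + 2 * \<delta>\<close> leaves room for Cramer's bound and for steps slightly below \<open>L\<close>.\<close>
  define A0 where "A0 = ln m - legendre (z + 2 * \<delta>) - \<delta>"
  have zL: "z + 2 * \<delta> < L" using \<delta> by simp
  have A0: "a < c * lb + (1 - c) * A0" using \<delta> by (simp add: A0_def algebra_simps)
  have A0_lb: "A0 \<le> lb" using lb \<delta> legendre_nonneg[OF zL] by (simp add: A0_def)
  \<comment> \<open>Chosen so that the loss \<open>\<delta>' * n\<close> of the forced steps is covered by the surplus \<open>\<delta> * r n\<close> of the free ones.\<close>
  define \<delta>' where "\<delta>' = \<delta> * (1 - c) / 2"
  have \<delta>': "0 < \<delta>'" using \<delta> c by (simp add: \<delta>'_def)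
  define l where "l = L - \<delta>'"
  define \<kappa> where "\<kappa> = pmf p b * measure \<mu> {l..} ^ b"
  have "measure \<mu> {l<..} \<le> measure \<mu> {l..}" by (intro step.finite_measure_mono) auto
  then have ml: "0 < measure \<mu> {l..}" using reaches[of l] \<delta>' by (simp add: l_def)
  then have \<kappa>: "0 < \<kappa>" "\<kappa> \<le> 1"
    using b pmf_le_1[of p b] unfolding \<kappa>_def by (auto intro!: mult_le_one power_le_one)
  obtain \<delta>0 \<rho> where base: "0 < \<delta>0" "1 \<le> \<rho>"
    "\<And>r y e. 0 < e \<Longrightarrow> e \<le> m ^ r * tail \<mu> r y \<Longrightarrow> e\<^sup>2 * (\<delta>0 / \<rho> ^ r)\<^sup>2 / (32 * exp 1) \<le> success r y (e / 2)"
    using success_base by blast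
  define C0 where "C0 = ln (\<delta>0\<^sup>2 / (32 * exp 1) * \<kappa>)"
  define A where "A = 1 + 2 * \<bar>A0\<bar> + 2 * ln \<rho>"
  define B where "B = 1 + \<bar>C0\<bar>"
  have ln\<rho>: "0 \<le> ln \<rho>" using base by simp
  define k where "k n = nat \<lceil>c * real n\<rceil>" for n
  define r where "r n = n - k n" for n
  have k: "c * real n \<le> real (k n)" "real (k n) \<le> c * real n + 1" "k n \<le> n" for n
  proof -
    have pos: "0 \<le> c * real n" using c by simp
    then have ceil: "real (k n) = of_int \<lceil>c * real n\<rceil>" by (simp add: k_def)
    show "c * real n \<le> real (k n)" "real (k n) \<le> c * real n + 1"
      unfolding ceil by linarith+
    have "c * real n \<le> 1 * real n" using c by (intro mult_right_mono) auto
    then have "\<lceil>c * real n\<rceil> \<le> int n" by (simp add: ceiling_le_iff)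
    then show "k n \<le> n" by (simp only: k_def nat_le_iff)
  qed
  have r: "real (r n) = real n - real (k n)" for n using k(3)[of n] unfolding r_def by (rule of_nat_diff)
  have r_top: "filterlim r at_top sequentially"
  proof -
    have "filterlim (\<lambda>n. (1 - c) * real n - 1) at_top sequentially" using c by real_asymp
    moreover have "\<forall>\<^sub>F n in sequentially. (1 - c) * real n - 1 \<le> real (r n)"
      using k by (intro always_eventually allI) (simp add: r algebra_simps)
    ultimately have "filterlim (\<lambda>n. real (r n)) at_top sequentially" by (rule filterlim_at_top_mono)
    then show ?thesis by (simp add: filterlim_sequentially_iff_filterlim_real)
  qed
  have "\<forall>\<^sub>F n in sequentially. exp (- real n * (legendre (z + 2 * \<delta>) + \<delta>)) \<le> tail \<mu> n (real n * (z + 2 * \<delta> - \<delta>))"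
    using z zL \<delta> by (intro cramer_lower) auto
  then have E1: "\<forall>\<^sub>F n in sequentially. exp (- real (r n) * (legendre (z + 2 * \<delta>) + \<delta>)) \<le>
      tail \<mu> (r n) (real (r n) * (z + 2 * \<delta> - \<delta>))"
    by (rule eventually_compose_filterlim[OF _ r_top])
  have E2: "\<forall>\<^sub>F n in sequentially. (1 - c) / 2 * real n \<le> (1 - c) * real n - 1"
    using c by real_asymp
  have E3: "\<forall>\<^sub>F n in sequentially. a * real n + ln 2 \<le> real n * (c * lb + (1 - c) * A0)"
  proof -
    define d where "d = c * lb + (1 - c) * A0 - a"
    have "0 < d" using A0 by (simp add: d_def)
    then have "\<forall>\<^sub>F n :: nat in sequentially. ln 2 \<le> real n * d" by real_asymp
    then show ?thesis by eventually_elim (simp add: d_def algebra_simps)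
  qed
  have "\<forall>\<^sub>F n in sequentially. 0 < success n (x * real n) (exp (a * real n)) \<and>
      - ln (success n (x * real n) (exp (a * real n))) \<le> real b ^ nat \<lceil>c * real n\<rceil> * (A * real n + B)"
    using E1 E2 E3
  proof eventually_elim
    case (elim n)
    define y where "y = real (r n) * (z + 2 * \<delta> - \<delta>)"
    define e where "e = exp (real (r n) * A0)"
    have "e = m ^ r n * exp (- real (r n) * (legendre (z + 2 * \<delta>) + \<delta>))"
    proof -
      have "m ^ r n = exp (real (r n) * ln m)" using mean_gt_1 by (simp add: exp_of_nat_mult)
      then show ?thesis by (simp add: e_def A0_def exp_add[symmetric] algebra_simps)
    qed
    also have "\<dots> \<le> m ^ r n * tail \<mu> (r n) y"
      unfolding y_def using elim(1) mean_gt_1 by (intro mult_left_mono) auto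
    finally have e: "0 < e" "e \<le> m ^ r n * tail \<mu> (r n) y" by (auto simp: e_def)
    define \<pi> where "\<pi> = e\<^sup>2 * (\<delta>0 / \<rho> ^ r n)\<^sup>2 / (32 * exp 1)"
    have \<pi>: "0 < \<pi>" using e base by (simp add: \<pi>_def)
    have \<pi>_le: "\<pi> \<le> success (r n) y (e / 2)" unfolding \<pi>_def by (rule base(3)[OF e])
    have yl: "x * real n \<le> y + real (k n) * l"
    proof -
      have "x * real n = c * real n * L + (real n - c * real n) * z"
        unfolding xz by (simp add: algebra_simps)
      moreover have "0 \<le> (real (k n) - c * real n) * (L - z)" using k z by simp
      moreover have "\<delta>' * real (k n) \<le> \<delta>' * real n" using \<delta>' k(3)[of n] by simp
      moreover have "\<delta>' * real n \<le> \<delta> * real (r n)"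
      proof -
        have "(1 - c) / 2 * real n \<le> real (r n)" using elim(2) k(2)[of n] by (simp add: r algebra_simps)
        then have "\<delta> * ((1 - c) / 2 * real n) \<le> \<delta> * real (r n)" using \<delta> by (intro mult_left_mono) auto
        then show ?thesis by (simp add: \<delta>'_def)
      qed
      ultimately show ?thesis unfolding y_def l_def r by (simp add: algebra_simps)
    qed
    have w: "exp (a * real n) \<le> real b ^ k n * (e / 2)"
    proof -
      have "real n * (c * lb + (1 - c) * A0) \<le> real (k n) * lb + real (r n) * A0"
      proof -
        have "0 \<le> (real (k n) - c * real n) * (lb - A0)" using k A0_lb by simp
        then show ?thesis by (simp add: r algebra_simps)
      qed
      then have "exp (a * real n + ln 2) \<le> exp (real (k n) * lb + real (r n) * A0)"
        using elim(3) by simp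
      also have "\<dots> = real b ^ k n * e"
      proof -
        have "real b ^ k n = exp (real (k n) * lb)" using b by (simp add: lb_def exp_of_nat_mult)
        then show ?thesis by (simp add: e_def exp_add)
      qed
      finally show ?thesis by (simp add: exp_add)
    qed
    have "(\<pi> * \<kappa>) ^ (b ^ k n) = \<pi> ^ (b ^ k n) * \<kappa> ^ (b ^ k n)" by (rule power_mult_distrib)
    also have "\<dots> \<le> success (r n) y (e / 2) ^ (b ^ k n) * \<kappa> ^ (b ^ k n - 1)"
      using \<pi> \<pi>_le \<kappa> by (intro mult_mono power_mono power_decreasing) auto
    also have "\<dots> \<le> success (k n + r n) (y + real (k n) * l) (real b ^ k n * (e / 2))"
      unfolding \<kappa>_def by (rule success_iterate[OF b(1)])
    also have "\<dots> \<le> success n (x * real n) (exp (a * real n))"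
      using success_mono[OF yl w, of n] k(3)[of n] by (simp add: r_def)
    finally have le: "(\<pi> * \<kappa>) ^ (b ^ k n) \<le> success n (x * real n) (exp (a * real n))" .
    have pos: "0 < (\<pi> * \<kappa>) ^ (b ^ k n)" using \<pi> \<kappa> by simp
    have "real b ^ k n * ln (\<pi> * \<kappa>) = ln ((\<pi> * \<kappa>) ^ (b ^ k n))"
      using \<pi> \<kappa> by (simp add: ln_realpow)
    also have "\<dots> \<le> ln (success n (x * real n) (exp (a * real n)))"
      using pos le by (subst ln_le_cancel_iff) auto
    finally have lnle: "- ln (success n (x * real n) (exp (a * real n))) \<le> real b ^ k n * (- ln (\<pi> * \<kappa>))"
      by simp
    have "\<pi> * \<kappa> = e\<^sup>2 / (\<rho> ^ r n)\<^sup>2 * (\<delta>0\<^sup>2 / (32 * exp 1) * \<kappa>)"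
      by (simp add: \<pi>_def power_divide)
    then have "ln (\<pi> * \<kappa>) = 2 * (real (r n) * A0) - 2 * (real (r n) * ln \<rho>) + C0"
      using e base \<kappa> by (simp add: ln_mult ln_div ln_realpow C0_def e_def)
    moreover have rn: "real (r n) \<le> real n" by (simp add: r_def)
    moreover have "\<bar>real (r n) * A0\<bar> \<le> real n * \<bar>A0\<bar>" "real (r n) * ln \<rho> \<le> real n * ln \<rho>"
      using ln\<rho> rn by (auto simp: abs_mult intro!: mult_right_mono)
    ultimately have "- ln (\<pi> * \<kappa>) \<le> A * real n + B"
      by (simp add: A_def B_def algebra_simps)
    then have "real b ^ k n * (- ln (\<pi> * \<kappa>)) \<le> real b ^ k n * (A * real n + B)"
      by (rule mult_left_mono) simp
    with lnle pos le show ?case unfolding k_def by linarith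
  qed
  then show ?thesis using ln\<rho> by (intro that[of A B]) (auto simp: A_def B_def)
qed

end

section \<open>Double logarithms and the hypotheses of the theorem\<close>

lemma liminf_double_log_pos:
  fixes P :: "nat \<Rightarrow> real"
  assumes \<eta>: "0 < \<eta>" and P0: "\<And>n. 0 \<le> P n"
    and P: "\<forall>\<^sub>F n in sequentially. P n \<le> exp (- exp (\<eta> * real n))"
  shows "0 < liminf (\<lambda>n. ereal (1 / real n) * elog (- elog (ereal (P n))))"
proof -
  have "ereal \<eta> \<le> liminf (\<lambda>n. ereal (1 / real n) * elog (- elog (ereal (P n))))"
  proof (rule Liminf_bounded)
    show "\<forall>\<^sub>F n in sequentially. ereal \<eta> \<le> ereal (1 / real n) * elog (- elog (ereal (P n)))"
      using P eventually_gt_at_top[of "0::nat"]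
    proof eventually_elim
      case (elim n)
      show ?case
      proof (cases "P n = 0")
        case True
        then show ?thesis using elim by (simp add: elog_def)
      next
        case False
        then have pos: "0 < P n" using P0[of n] by simp
        then have "ln (P n) \<le> ln (exp (- exp (\<eta> * real n)))"
          using elim by (subst ln_le_cancel_iff) auto
        then have l: "exp (\<eta> * real n) \<le> - ln (P n)" by simp
        then have l0: "0 < - ln (P n)" using exp_gt_zero[of "\<eta> * real n"] by linarith
        have "ln (exp (\<eta> * real n)) \<le> ln (- ln (P n))"
          using l l0 by (subst ln_le_cancel_iff) auto
        then have "\<eta> \<le> 1 / real n * ln (- ln (P n))" using elim by (simp add: field_simps)
        then show ?thesis using pos l0 by (simp add: elog_def)
      qed
    qed
  qed
  then show ?thesis using \<eta> by (meson ereal_less(2) less_le_trans)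
qed

text \<open>
  The polynomial factor \<open>A * n + B\<close> disappears under the second logarithm.
\<close>

lemma limsup_double_log_le:
  fixes P :: "nat \<Rightarrow> real" and b :: nat
  assumes b: "2 \<le> b" and c: "0 < c" and A: "0 < A" "1 \<le> B" and P1: "\<And>n. P n \<le> 1"
    and P: "\<forall>\<^sub>F n in sequentially. 0 < P n \<and> - ln (P n) \<le> real b ^ nat \<lceil>c * real n\<rceil> * (A * real n + B)"
  shows "limsup (\<lambda>n. ereal (1 / real n) * elog (- elog (ereal (P n)))) \<le> ereal (c * ln (real b))"
proof -
  define lb where "lb = ln (real b)"
  have lb: "0 < lb" using b by (simp add: lb_def)
  define U where "U n = ((c * real n + 1) * lb + ln (A * real n + B)) / real n" for n
  have "U \<longlonglongrightarrow> c * lb" unfolding U_def using A lb c by real_asymp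
  then have "limsup (\<lambda>n. ereal (U n)) = ereal (c * lb)"
    by (intro lim_imp_Limsup) auto
  moreover have "limsup (\<lambda>n. ereal (1 / real n) * elog (- elog (ereal (P n)))) \<le> limsup (\<lambda>n. ereal (U n))"
  proof (rule Limsup_mono)
    show "\<forall>\<^sub>F n in sequentially. ereal (1 / real n) * elog (- elog (ereal (P n))) \<le> ereal (U n)"
      using P eventually_gt_at_top[of "0::nat"]
    proof eventually_elim
      case (elim n)
      have el: "elog (ereal (P n)) = ereal (ln (P n))" using elim by (simp add: elog_def)
      show ?case
      proof (cases "P n = 1")
        case True
        then show ?thesis using elim by (simp add: elog_def)
      next
        case False
        then have "P n < 1" using P1[of n] by simp
        then have l0: "0 < - ln (P n)" using elim by simp
        have AB: "0 < A * real n + B" using A by (simp add: add_nonneg_pos)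
        have "real (nat \<lceil>c * real n\<rceil>) \<le> c * real n + 1"
        proof -
          have "0 \<le> c * real n" using c by simp
          then have "real (nat \<lceil>c * real n\<rceil>) = of_int \<lceil>c * real n\<rceil>" by simp
          then show ?thesis by linarith
        qed
        then have k: "real (nat \<lceil>c * real n\<rceil>) * lb \<le> (c * real n + 1) * lb"
          using lb by (intro mult_right_mono) auto
        have "ln (- ln (P n)) \<le> ln (real b ^ nat \<lceil>c * real n\<rceil> * (A * real n + B))"
          using l0 elim AB b by (subst ln_le_cancel_iff) auto
        also have "\<dots> = real (nat \<lceil>c * real n\<rceil>) * lb + ln (A * real n + B)"
          using b AB by (simp add: ln_mult ln_realpow lb_def)
        also have "\<dots> \<le> (c * real n + 1) * lb + ln (A * real n + B)" using k by simp
        finally have "1 / real n * ln (- ln (P n)) \<le> U n"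
          using elim by (simp add: U_def divide_right_mono)
        then show ?thesis using l0 elim by (simp add: el elog_def)
      qed
    qed
  qed
  ultimately show ?thesis by (simp add: lb_def)
qed

text \<open>
  The set defining \<open>b_val\<close> is nonempty, since a variable cannot be smaller than its mean almost surely.
\<close>

lemma b_val:
  assumes "summable (\<lambda>k. real k * pmf p k)"
  shows "offspring_mean p \<le> real (b_val p)" "0 < pmf p (b_val p)"
proof -
  let ?S = "{k. offspring_mean p \<le> real k \<and> 0 < pmf p k}"
  have nn: "0 \<le> offspring_mean p"
    unfolding offspring_mean_def using assms by (intro suminf_nonneg) auto
  have "?S \<noteq> {}"
  proof
    assume empty: "?S = {}"
    have "measure_pmf.expectation p real = offspring_mean p"
      by (subst integral_eq_nn_integral) (auto simp: nn_integral_real_pmf[OF assms] nn)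
    moreover have "measure_pmf.expectation p real < offspring_mean p"
    proof (rule measure_pmf.expectation_less)
      show "integrable (measure_pmf p) real"
        by (rule integrableI_nonneg) (auto simp: nn_integral_real_pmf[OF assms])
      show "AE k in measure_pmf p. real k < offspring_mean p"
      proof (rule AE_pmfI)
        fix k assume "k \<in> set_pmf p"
        then have "0 < pmf p k" by (simp add: pmf_positive)
        then show "real k < offspring_mean p" using empty by (auto simp: not_le[symmetric])
      qed
    qed
    ultimately show False by simp
  qed
  then have "b_val p \<in> ?S"
    unfolding b_val_def by (intro Inf_nat_def1)
  then show "offspring_mean p \<le> real (b_val p)" "0 < pmf p (b_val p)" by auto
qed

lemma (in branching_random_walk) measure_brw_count:
  "measure M {\<omega> \<in> space M. w \<le> real (brw_count N D n {y..} \<omega>)} = success n y w"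
proof -
  have "Measurable.pred law (\<lambda>f. w \<le> real (descendants n y f))" by measurable
  then have S: "{f. w \<le> real (descendants n y f)} \<in> sets law" by (simp add: pred_def space_law)
  have "measure law {f. w \<le> real (descendants n y f)} =
      measure M (family N D -` {f. w \<le> real (descendants n y f)} \<inter> space M)"
    unfolding distr_family[symmetric] using S by (intro measure_distr) (auto simp: sets_family_law)
  also have "family N D -` {f. w \<le> real (descendants n y f)} \<inter> space M =
      {\<omega> \<in> space M. w \<le> real (brw_count N D n {y..} \<omega>)}"
    by (auto simp: brw_count_eq_descendants)
  finally show ?thesis by (simp add: success_def space_law)
qed

lemma step_sup_bounds:
  assumes "real_distribution \<mu>" "step_sup \<mu> = ereal L"
  shows "AE y in \<mu>. y \<le> L" "\<And>y. y < L \<Longrightarrow> 0 < measure \<mu> {y<..}"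
proof -
  interpret real_distribution \<mu> by fact
  have "AE y in \<mu>. y \<le> L + 1 / real (Suc k)" for k
  proof -
    have "\<not> 0 < measure \<mu> {L + 1 / real (Suc k)<..}"
    proof
      assume "0 < measure \<mu> {L + 1 / real (Suc k)<..}"
      then have "ereal (L + 1 / real (Suc k)) \<le> step_sup \<mu>"
        unfolding step_sup_def by (intro Sup_upper) auto
      then show False by (simp add: assms(2))
    qed
    then have "prob {L + 1 / real (Suc k)<..} = 0" using zero_less_measure_iff by blast
    then have "AE y in \<mu>. y \<notin> {L + 1 / real (Suc k)<..}"
      by (subst (asm) prob_eq_0) auto
    then show ?thesis by (simp add: not_less)
  qed
  then have "AE y in \<mu>. \<forall>k. y \<le> L + 1 / real (Suc k)" by (simp add: AE_all_countable)
  then show "AE y in \<mu>. y \<le> L"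
  proof eventually_elim
    case (elim y)
    show ?case
    proof (rule field_le_epsilon)
      fix e :: real assume "0 < e"
      then obtain k where "1 / real (Suc k) < e" using nat_approx_posE by blast
      then show "y \<le> L + e" using elim[rule_format, of k] by linarith
    qed
  qed
  fix y assume "y < L"
  then have "ereal y < step_sup \<mu>" by (simp add: assms(2))
  then obtain y' where y': "y < y'" "0 < measure \<mu> {y'<..}"
    unfolding step_sup_def by (auto simp: less_Sup_iff)
  then have "measure \<mu> {y'<..} \<le> measure \<mu> {y<..}" by (intro finite_measure_mono) auto
  then show "0 < measure \<mu> {y<..}" using y' by simp
qed

lemma (in branching_random_walk) brw_count_first_generation: "brw_count N D 1 UNIV \<omega> = N [] \<omega>"
proof -
  have "{u. length u = 1 \<and> born N \<omega> u \<and> position D \<omega> u \<in> UNIV} = (\<lambda>i. [i]) ` {..<N [] \<omega>}"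
    by (auto simp: length_Suc_conv)
  then show ?thesis by (simp add: brw_count_def card_image inj_on_def)
qed

lemma (in branching_random_walk) nn_integral_exp_offspring:
  assumes "integrable M (\<lambda>\<omega>. exp (\<theta> * real (brw_count N D 1 UNIV \<omega>)))"
  shows "(\<integral>\<^sup>+k. ennreal (exp (\<theta> * real k)) \<partial>measure_pmf p) < \<infinity>"
proof -
  have "(\<integral>\<^sup>+k. ennreal (exp (\<theta> * real k)) \<partial>measure_pmf p) = (\<integral>\<^sup>+\<omega>. ennreal (exp (\<theta> * real (N [] \<omega>))) \<partial>M)"
    unfolding offspring_distr[of "[]", symmetric] by (subst nn_integral_distr) auto
  also have "\<dots> = (\<integral>\<^sup>+\<omega>. ennreal (exp (\<theta> * real (brw_count N D 1 UNIV \<omega>))) \<partial>M)"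
    by (simp only: brw_count_first_generation)
  also have "\<dots> = ennreal (\<integral>\<omega>. exp (\<theta> * real (brw_count N D 1 UNIV \<omega>)) \<partial>M)"
    using assms by (rule nn_integral_eq_integral) simp
  finally show ?thesis by simp
qed

theorem theorem1p2:
  fixes M :: "'w measure" and p :: "nat pmf" and \<mu> :: "real measure"
    and N :: "nat list \<Rightarrow> 'w \<Rightarrow> nat" and D :: "nat list \<Rightarrow> nat \<Rightarrow> 'w \<Rightarrow> real"
    and \<theta> \<kappa> L x a :: real
  assumes brw: "branching_random_walk M p \<mu> N D"
    and p0: "pmf p 0 = 0"
    and mean_finite: "summable (\<lambda>k. real k * pmf p k)"
    and mean_gt_1: "1 < offspring_mean p"
    and step_integrable: "integrable \<mu> (\<lambda>y. y)"
    and step_centred: "(\<integral>y. y \<partial>\<mu>) = 0"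
    and step_nontrivial: "measure \<mu> {0} < 1"
    and \<kappa>: "\<kappa> > 0" "integrable \<mu> (\<lambda>y. exp (\<kappa> * y))"
    and \<theta>: "\<theta> > 0" "integrable M (\<lambda>\<omega>. exp (\<theta> * real (brw_count N D 1 UNIV \<omega>)))"
    and L_finite: "step_sup \<mu> = ereal L"
    and x: "0 < x" "x < L"
    and a: "max (ereal (ln (offspring_mean p)) - rate \<mu> x) 0 < ereal a" "a < ln (offspring_mean p)"
    and cond: "max_speed p \<mu> = ereal L \<or>
      (max_speed p \<mu> < ereal L \<and>
       (\<forall>s. 0 < s \<and> s \<le> 1 - a / ln (offspring_mean p) \<longrightarrow> y_sol p \<mu> x a s / s > L))"
  shows "let F = (\<lambda>n. ereal (1 / real n) *
                   elog (- elog (ereal (measure M {\<omega> \<in> space M.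
                     real (brw_count N D n {x * real n..} \<omega>) \<ge> exp (a * real n)}))))
         in \<exists>c. (0 < c \<and> c < x / L \<and> solves_c_eq p \<mu> L x a c) \<and>
                (\<forall>c'. 0 < c' \<and> c' < x / L \<and> solves_c_eq p \<mu> L x a c' \<longrightarrow> c' = c) \<and>
                0 < liminf F \<and> liminf F \<le> limsup F \<and>
                limsup F \<le> ereal (c * ln (real (b_val p)))"
proof -
  define l where "l = ln (offspring_mean p)"
  define b where "b = b_val p"
  define P where "P n = measure M {\<omega> \<in> space M.
    real (brw_count N D n {x * real n..} \<omega>) \<ge> exp (a * real n)}" for n :: nat
  interpret branching_random_walk M p \<mu> N D by (rule brw)
  interpret bounded_step \<mu> L
  proof
    show "AE y in \<mu>. y \<le> L" "\<And>y. y < L \<Longrightarrow> 0 < measure \<mu> {y<..}"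
      using step_sup_bounds[OF step_law L_finite] by auto
  qed (use step_integrable step_centred x in auto)
  interpret bounded_brw M p \<mu> N D L \<theta>
  proof
    show "(\<integral>\<^sup>+k. ennreal (exp (\<theta> * real k)) \<partial>measure_pmf p) < \<infinity>"
      by (rule nn_integral_exp_offspring[OF \<theta>(2)])
  qed (use mean_finite mean_gt_1 \<theta> in auto)
  have P_eq: "P n = success n (x * real n) (exp (a * real n))" for n
    unfolding P_def by (rule measure_brw_count)
  have a': "l - legendre x < a" "0 < a" "a < l"
    using a x(2) by (auto simp: rate_eq_legendre l_def)
  have b: "offspring_mean p \<le> real b" "0 < pmf p b"
    using b_val[OF mean_finite] by (auto simp: b_def)
  then have b2: "2 \<le> b" using mean_gt_1 by linarith
  have lb: "l \<le> ln (real b)" using b mean_gt_1 by (simp add: l_def)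
  have xL: "x / L < 1" using x by simp
  obtain c where c: "0 < c" "c < x / L" "c * ln (real b) + (1 - c) * l - remaining x c = a"
    "\<And>c'. c < c' \<Longrightarrow> c' \<le> x / L \<Longrightarrow> a < c' * ln (real b) + (1 - c') * l - remaining x c'"
    "\<And>c'. 0 < c' \<Longrightarrow> c' < x / L \<Longrightarrow> c' * ln (real b) + (1 - c') * l - remaining x c' = a \<Longrightarrow> c' = c"
    using critical_time[OF x a'(1) a'(3) lb] by blast
  define F where "F n = ereal (1 / real n) * elog (- elog (ereal (P n)))" for n
  have pos: "0 < liminf F"
  proof -
    obtain \<gamma> where \<gamma>: "0 \<le> \<gamma>" "\<gamma> < a"
        "\<And>s. 0 \<le> s \<Longrightarrow> s < 1 \<Longrightarrow> (1 - s) * (l - legendre ((x - s * L) / (1 - s))) \<le> \<gamma>"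
      using growth_bound[of x p a] x a' cond unfolding l_def by blast
    obtain \<eta> where "0 < \<eta>" "\<forall>\<^sub>F n in sequentially. P n \<le> exp (- exp (\<eta> * real n))"
      unfolding P_eq using double_exponential_decay[OF x(2) \<gamma>(1,2)] \<gamma>(3) unfolding l_def by blast
    then show ?thesis
      unfolding F_def by (intro liminf_double_log_pos) (auto simp: P_def)
  qed
  have le: "liminf F \<le> limsup F" by (rule Liminf_le_Limsup) simp
  \<comment> \<open>Forcing up to any time \<open>c' > c\<close> succeeds; then \<open>c'\<close> tends to \<open>c\<close>.\<close>
  have upper: "limsup F \<le> ereal (c * ln (real b))"
  proof (rule tendsto_lowerbound)
    show "((\<lambda>c'. ereal (c' * ln (real b))) \<longlongrightarrow> ereal (c * ln (real b))) (at_right c)"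
      by (intro tendsto_intros)
    have "\<forall>\<^sub>F c' in at_right c. c' < x / L"
      by (rule order_tendstoD(2)[OF tendsto_ident_at c(2)])
    moreover have "\<forall>\<^sub>F c' in at_right c. c < c'" by (rule eventually_at_right_less)
    ultimately show "\<forall>\<^sub>F c' in at_right c. limsup F \<le> ereal (c' * ln (real b))"
    proof eventually_elim
      case (elim c')
      have "0 < c'" "c' < 1" using elim c xL by linarith+
      moreover have "c' * L < x" using elim L_pos by (simp add: field_simps)
      moreover have "a < c' * ln (real b) + (1 - c') * ln (offspring_mean p) - remaining x c'"
        using c(4)[of c'] elim by (simp add: l_def)
      ultimately obtain A B where "0 < A" "1 \<le> B" "\<forall>\<^sub>F n in sequentially. 0 < P n \<and>
          - ln (P n) \<le> real b ^ nat \<lceil>c' * real n\<rceil> * (A * real n + B)"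
        using double_exponential_attained[OF b2 b x(2)] unfolding P_eq by blast
      then show ?case
        unfolding F_def using b2 \<open>0 < c'\<close> by (intro limsup_double_log_le) (auto simp: P_def)
    qed
  qed simp
  have sol: "solves_c_eq p \<mu> L x a c"
    unfolding solves_c_eq_iff[OF x c(1,2)] using c(3) by (simp only: b_def l_def)
  have "c' = c" if "0 < c'" "c' < x / L" "solves_c_eq p \<mu> L x a c'" for c'
  proof (rule c(5)[OF that(1,2)])
    show "c' * ln (real b) + (1 - c') * l - remaining x c' = a"
      using that(3) unfolding solves_c_eq_iff[OF x that(1,2)] by (simp only: b_def l_def)
  qed
  then have uniq: "\<forall>c'. 0 < c' \<and> c' < x / L \<and> solves_c_eq p \<mu> L x a c' \<longrightarrow> c' = c" by blast
  have F: "F = (\<lambda>n. ereal (1 / real n) *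
                   elog (- elog (ereal (measure M {\<omega> \<in> space M.
                     real (brw_count N D n {x * real n..} \<omega>) \<ge> exp (a * real n)}))))"
    by (rule ext) (simp only: F_def P_def)
  show ?thesis
    unfolding Let_def F[symmetric] b_def[symmetric]
    by (intro exI[of _ c] conjI c(1) c(2) sol uniq pos le upper)
qed

end
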